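(* (1a) For every ordered set $\mathcal N$ let $\mathcal Q_{\mathcal N}$ be an operator acting only on the auxiliary spaces labelled by $\mathcal N$ such that, for all sets $\mathcal M'$ disjoint from $\mathcal N$, $$[\mathcal Q_{\mathcal N},R_{\mathcal M'\mathcal N}(\lambda_{\mathcal N}\pm\lambda_{\mathcal M'})]=0,\qquad[\mathcal Q_{\mathcal N},R_{\bar{\mathcal N}\mathcal M'}(-\lambda_{\mathcal N}\pm\lambda_{\mathcal M'})]=0.$$ If $\{\mathcal K_{\mathcal N}\}$ is a set of solutions of the generalized dual reflection equations, then $\{\mathcal Q_{\mathcal N}\mathcal K_{\mathcal N}\}$ is again a set of solutions of the generalized dual reflection equations. Similarly, if $\{\mathcal T_{\mathcal N}\}$ is a set of solutions of the generalized reflection equations, then so is $\{\mathcal T_{\mathcal N}\mathcal Q_{\mathcal N}\}$. (1b) For every ordered set $\mathcal N$ let $\mathcal S_{\mathcal N}$ be an operator acting only on the auxiliary spaces labelled by $\mathcal N$ such that, for all sets $\mathcal M'$ disjoint from $\mathcal N$, $$[\mathcal S_{\mathcal N},R_{\mathcal N\mathcal M'}(\lambda_{\mathcal N}\pm\lambda_{\mathcal M'})]=0,\qquad[\mathcal S_{\mathcal N},R_{\mathcal M'\bar{\mathcal N}}(-\lambda_{\mathcal N}\pm\lambda_{\mathcal M'})]=0.$$ If $\{\mathcal K_{\mathcal N}\}$ is a set of solutions of the generalized dual reflection equations, then $\{\mathcal K_{\mathcal N}\mathcal S_{\mathcal N}\}$ is again a set of solutions of the generalized dual reflection equations. Similarly,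 if $\{\mathcal T_{\mathcal N}\}$ is a set of solutions of the generalized reflection equations, then so is $\{\mathcal S_{\mathcal N}\mathcal T_{\mathcal N}\}$.
   Context: $V$ is a finite-dimensional complex vector space (auxiliary space); $V_i$ denotes a copy of $V$ labelled by $i$, and subscripts indicate the copies on which an operator acts. To each label $i$ is attached a spectral parameter $\lambda_i\in\mathbb C$. All identities (including the commutation hypotheses) hold for generic values of the parameters. $\mathcal Q_{\mathcal N}$, $\mathcal S_{\mathcal N}$ are c-number operators on $V_1\otimes\cdots\otimes V_n$ (identity on quantum spaces), possibly depending on $\lambda_{\mathcal N}$. $R(\lambda)\in\mathrm{End}(V\otimes V)$ is a c-number matrix, $R_{21}=P_{12}R_{12}P_{12}$ with $P_{12}$ the permutation of the two factors, and $t_i$ denotes transposition in the space $V_i$. Standing assumptions on $R$: (I) Yang--Baxter equation: $R_{12}(\lambda_1-\lambda_2)R_{13}(\lambda_1)R_{23}(\lambda_2)=R_{23}(\lambda_2)R_{13}(\lambda_1)R_{12}(\lambda_1-\lambda_2)$. (II) $R_{12}(\lambda)=R_{21}(\lambda)^{t_1t_2}$. (III) Unitarity $R_{12}(\lambda)R_{21}(-\lambda)\propto 1$; crossing $R_{12}(\lambda)=V_1R_{12}^{t_2}(-\lambda-\rho)V_1=V_2^{t_2}R_{12}^{t_1}(-\lambda-\rho)V_2^{t_2}$; crossing-unitarity $R_{21}(\lambda)^{t_1}M_1^{-1}R_{12}(-\lambda-2\rho)^{t_1}M_1\propto 1$; and $[R_{12}(\lambda),M_1M_2]=0$. Here (in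 these crossing formulas only) $V_i$ denotes a c-number matrix $V$ with $V^2=1$ acting on the $i$-th space, $M=V^tV$, and $\rho$ is a fixed constant. The sign $\propto$ means equality up to a nonzero scalar function. For an ordered set of labels $\mathcal X=\langle x_1,\dots,x_a\rangle$, $M_{\mathcal X}=M_{x_1}\cdots M_{x_a}$. Fused $R$-matrices: for disjoint ordered sets of labels $\mathcal X=\langle x_1,\dots,x_a\rangle$ and $\mathcal Y=\langle y_1,\dots,y_b\rangle$, $$R_{\mathcal X\mathcal Y}=\big(R_{x_1y_1}R_{x_2y_1}\cdots R_{x_ay_1}\big)\big(R_{x_1y_2}\cdots R_{x_ay_2}\big)\cdots\big(R_{x_1y_b}\cdots R_{x_ay_b}\big).$$ An argument such as $\epsilon\lambda_{\mathcal X}+\epsilon'\lambda_{\mathcal Y}+c$ means that each factor $R_{xy}$ is evaluated at $\epsilon\lambda_x+\epsilon'\lambda_y+c$. For an ordered set $\mathcal N=\langle 1,\dots,n\rangle$, $\bar{\mathcal N}=\langle n,n-1,\dots,1\rangle$ is the set in reversed order. A set of solutions of the generalized reflection equations is a family $\mathcal T_{\mathcal N}(\lambda_{\mathcal N})$, one for each length $n\ge1$, of matrices acting on $V_1\otimes\cdots\otimes V_n$ with entries operators on a fixed quantum space (labelled $q$, possibly including a boundary space), such that for all disjoint $\mathcal N=\langle1,\dots,n\rangle$, $\mathcal M'=\langle1',\dots,m'\rangle$ $$\mathcal T_{\mathcal N}(\lambda_{\mathcal N})R_{\mathcal M'\mathcal N}(\lambda_{\mathcal N}+\lambda_{\mathcal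 M'})\mathcal T_{\mathcal M'}(\lambda_{\mathcal M'})R_{\bar{\mathcal N}\mathcal M'}(-\lambda_{\bar{\mathcal N}}+\lambda_{\mathcal M'})=R_{\mathcal M'\bar{\mathcal N}}(-\lambda_{\bar{\mathcal N}}+\lambda_{\mathcal M'})\mathcal T_{\mathcal M'}(\lambda_{\mathcal M'})R_{\mathcal N\mathcal M'}(\lambda_{\mathcal N}+\lambda_{\mathcal M'})\mathcal T_{\mathcal N}(\lambda_{\mathcal N}).$$ A set of solutions of the generalized dual reflection equations is a family $\mathcal K_{\mathcal N}(\lambda_{\mathcal N})$ of matrices acting on $V_1\otimes\cdots\otimes V_n$ with entries operators on a fixed quantum space (labelled $q'$, possibly including a boundary space), such that for all disjoint $\mathcal N,\mathcal M'$ $$\mathcal K_{\mathcal N}(\lambda_{\mathcal N})M_{\mathcal M'}R_{\bar{\mathcal M}'\bar{\mathcal N}}(-\lambda_{\bar{\mathcal N}}-\lambda_{\bar{\mathcal M}'}-2\rho)M_{\mathcal M'}^{-1}\mathcal K_{\mathcal M'}(\lambda_{\mathcal M'})R_{\mathcal N\bar{\mathcal M}'}(\lambda_{\mathcal N}-\lambda_{\bar{\mathcal M}'})$$ $$=R_{\bar{\mathcal M}'\mathcal N}(\lambda_{\mathcal N}-\lambda_{\bar{\mathcal M}'})\mathcal K_{\mathcal M'}(\lambda_{\mathcal M'})M_{\mathcal M'}^{-1}R_{\bar{\mathcal N}\bar{\mathcal M}'}(-\lambda_{\bar{\mathcal N}}-\lambda_{\bar{\mathcal M}'}-2\rho)M_{\mathcal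 M'}\mathcal K_{\mathcal N}(\lambda_{\mathcal N}).$$ *)

theory Defs
  imports "HOL-Analysis.Analysis"
begin

text \<open>
  The auxiliary space is \<open>complex ^ 'd\<close>; \<open>R\<close> takes values in \<open>End (V \<otimes> V)\<close>, i.e. in matrices indexed
  by \<open>'d \<times> 'd\<close>.  Rows are outputs and columns inputs, as for \<open>*v\<close>.

  An identity holds generically if it holds on a dense open set of parameter values.  For a
  statement about a label assignment \<open>l :: nat \<Rightarrow> complex\<close> that only involves finitely many labels,
  this is the same as a dense open subset of the finite-dimensional parameter space, because
  \<open>nat \<Rightarrow> complex\<close> carries the product topology.
\<close>

definition generically :: "('a::topological_space \<Rightarrow> bool) \<Rightarrow> bool" where
  "generically P \<longleftrightarrow> (\<exists>U. open U \<and> closure U = UNIV \<and> (\<forall>u\<in>U. P u))"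

definition tensor :: "complex^('d::finite)^'d \<Rightarrow> complex^'d^'d \<Rightarrow> complex^('d \<times> 'd)^('d \<times> 'd)" where
  "tensor A B = (\<chi> i j. A $ fst i $ fst j * B $ snd i $ snd j)"

definition permutation_matrix :: "complex^('d::finite \<times> 'd)^('d \<times> 'd)" where
  "permutation_matrix = (\<chi> i j. if fst i = snd j \<and> snd i = fst j then 1 else 0)"

definition flip :: "complex^('d::finite \<times> 'd)^('d \<times> 'd) \<Rightarrow> complex^('d \<times> 'd)^('d \<times> 'd)" where
  "flip A = permutation_matrix ** A ** permutation_matrix"

definition transpose1 :: "complex^('d::finite \<times> 'd)^('d \<times> 'd) \<Rightarrow> complex^('d \<times> 'd)^('d \<times> 'd)" where
  "transpose1 A = (\<chi> i j. A $ (fst j, snd i) $ (fst i, snd j))"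

definition transpose2 :: "complex^('d::finite \<times> 'd)^('d \<times> 'd) \<Rightarrow> complex^('d \<times> 'd)^('d \<times> 'd)" where
  "transpose2 A = (\<chi> i j. A $ (fst i, snd j) $ (fst j, snd i))"

text \<open>
  The quantum space is a complex vector space \<open>'w\<close> of arbitrary dimension with scalar
  multiplication \<open>s\<close>.  Vectors of (auxiliary spaces) \<open>\<otimes>\<close> (quantum space) are functions from basis
  configurations \<open>nat \<Rightarrow> 'd\<close>, which give a basis index for each label, to \<open>'w\<close>.  The copies of \<open>V\<close>
  for all labels are present at once.  An operator placed on the labels \<open>X\<close> leaves all other labels
  untouched, so an identity between operators placed on labels in a finite set \<open>L\<close> holds here iff it
  holds on \<open>(\<Otimes>x\<in>L. V\<^sub>x) \<otimes> 'w\<close>.  The product of operators is composition.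
\<close>

type_synonym ('d, 'w) lab_op = "((nat \<Rightarrow> 'd) \<Rightarrow> 'w) \<Rightarrow> ((nat \<Rightarrow> 'd) \<Rightarrow> 'w)"

text \<open>
  A matrix on \<open>V\<^sub>1 \<otimes> \<dots> \<otimes> V\<^sub>n\<close> with operator entries is a function of a row and a column index, both
  lists of length \<open>n\<close>; its values at lists of other lengths play no role.
\<close>

definition place :: "nat list \<Rightarrow> ('d::finite list \<Rightarrow> 'd list \<Rightarrow> 'w \<Rightarrow> 'w) \<Rightarrow> ('d, 'w::ab_group_add) lab_op"
  where
  "place X A f c = (\<Sum>c' \<in> {c'. \<forall>x. x \<notin> set X \<longrightarrow> c' x = c x}. A (map c X) (map c' X) (f c'))"

definition cnumber :: "(complex \<Rightarrow> 'w \<Rightarrow> 'w) \<Rightarrow> ('d list \<Rightarrow> 'd list \<Rightarrow> complex) \<Rightarrow> 'd list \<Rightarrow> 'd list \<Rightarrow> 'w \<Rightarrow> 'w"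
  where "cnumber s A a b = s (A a b)"

definition on_site :: "(complex \<Rightarrow> 'w \<Rightarrow> 'w) \<Rightarrow> complex^'d^'d \<Rightarrow> nat \<Rightarrow> ('d::finite, 'w::ab_group_add) lab_op"
  where "on_site s A x = place [x] (cnumber s (\<lambda>a b. A $ (a!0) $ (b!0)))"

definition on_sites ::
  "(complex \<Rightarrow> 'w \<Rightarrow> 'w) \<Rightarrow> complex^('d \<times> 'd)^('d \<times> 'd) \<Rightarrow> nat \<Rightarrow> nat \<Rightarrow> ('d::finite, 'w::ab_group_add) lab_op"
  where "on_sites s A x y = place [x, y] (cnumber s (\<lambda>a b. A $ (a!0, a!1) $ (b!0, b!1)))"

definition op_prod :: "('d, 'w) lab_op list \<Rightarrow> ('d, 'w) lab_op" where
  "op_prod As = foldr (\<circ>) As id"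

definition site_prod ::
  "(complex \<Rightarrow> 'w \<Rightarrow> 'w) \<Rightarrow> complex^'d^'d \<Rightarrow> nat list \<Rightarrow> ('d::finite, 'w::ab_group_add) lab_op" where
  "site_prod s A X = op_prod (map (on_site s A) X)"

text \<open>The argument of the factor \<open>R\<^sub>x\<^sub>y\<close> of a fused \<open>R\<close>-matrix is \<open>g x y\<close>.\<close>

definition fused ::
  "(complex \<Rightarrow> 'w \<Rightarrow> 'w) \<Rightarrow> (complex \<Rightarrow> complex^('d \<times> 'd)^('d \<times> 'd)) \<Rightarrow> (nat \<Rightarrow> nat \<Rightarrow> complex)
    \<Rightarrow> nat list \<Rightarrow> nat list \<Rightarrow> ('d::finite, 'w::ab_group_add) lab_op" where
  "fused s R g X Y =
     op_prod (concat (map (\<lambda>y. map (\<lambda>x. on_sites s (R (g x y)) x y) X) Y))"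

definition yang_baxter :: "(complex \<Rightarrow> complex^('d::finite \<times> 'd)^('d \<times> 'd)) \<Rightarrow> bool" where
  "yang_baxter R \<longleftrightarrow> generically (\<lambda>(u, v).
     on_sites (*) (R (u - v)) 1 2 \<circ> on_sites (*) (R u) 1 3 \<circ> on_sites (*) (R v) 2 3
     = on_sites (*) (R v) 2 3 \<circ> on_sites (*) (R u) 1 3 \<circ> on_sites (*) (R (u - v)) 1 2)"

definition transposition_symmetric :: "(complex \<Rightarrow> complex^('d::finite \<times> 'd)^('d \<times> 'd)) \<Rightarrow> bool" where
  "transposition_symmetric R \<longleftrightarrow>
     generically (\<lambda>u. R u = transpose1 (transpose2 (flip (R u))))"

definition unitarity :: "(complex \<Rightarrow> complex^('d::finite \<times> 'd)^('d \<times> 'd)) \<Rightarrow> bool" where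
  "unitarity R \<longleftrightarrow> generically (\<lambda>u. \<exists>k. k \<noteq> 0 \<and> R u ** flip (R (- u)) = mat k)"

definition crossing ::
  "(complex \<Rightarrow> complex^('d::finite \<times> 'd)^('d \<times> 'd)) \<Rightarrow> complex^'d^'d \<Rightarrow> complex \<Rightarrow> bool" where
  "crossing R V \<rho> \<longleftrightarrow> generically (\<lambda>u.
     R u = tensor V (mat 1) ** transpose2 (R (- u - \<rho>)) ** tensor V (mat 1) \<and>
     R u = tensor (mat 1) (transpose V) ** transpose1 (R (- u - \<rho>)) ** tensor (mat 1) (transpose V))"

definition crossing_unitarity ::
  "(complex \<Rightarrow> complex^('d::finite \<times> 'd)^('d \<times> 'd)) \<Rightarrow> complex^'d^'d \<Rightarrow> complex \<Rightarrow> bool" where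
  "crossing_unitarity R M \<rho> \<longleftrightarrow> generically (\<lambda>u. \<exists>k. k \<noteq> 0 \<and>
     transpose1 (flip (R u)) ** tensor (matrix_inv M) (mat 1)
       ** transpose1 (R (- u - 2 * \<rho>)) ** tensor M (mat 1) = mat k)"

definition commutes_with_MM ::
  "(complex \<Rightarrow> complex^('d::finite \<times> 'd)^('d \<times> 'd)) \<Rightarrow> complex^'d^'d \<Rightarrow> bool" where
  "commutes_with_MM R M \<longleftrightarrow> generically (\<lambda>u. R u ** tensor M M = tensor M M ** R u)"

text \<open>
  A family has one member for each length \<open>n \<ge> 1\<close>, depending on \<open>n\<close> spectral parameters.  As \<open>n\<close> is the
  length of the parameter list, it is not a separate argument.  The member attached to the ordered
  label set \<open>X\<close> is the one of length \<open>length X\<close> placed on \<open>X\<close>, with the parameters of \<open>X\<close>.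
\<close>

type_synonym ('d, 'w) family = "complex list \<Rightarrow> 'd list \<Rightarrow> 'd list \<Rightarrow> 'w \<Rightarrow> 'w"
type_synonym 'd cfamily = "complex list \<Rightarrow> 'd list \<Rightarrow> 'd list \<Rightarrow> complex"

definition fam_at ::
  "('d, 'w) family \<Rightarrow> nat list \<Rightarrow> (nat \<Rightarrow> complex) \<Rightarrow> ('d::finite, 'w::ab_group_add) lab_op" where
  "fam_at A X l = place X (A (map l X))"

definition cnumber_family :: "(complex \<Rightarrow> 'w \<Rightarrow> 'w) \<Rightarrow> 'd cfamily \<Rightarrow> ('d, 'w) family" where
  "cnumber_family s Q ls = cnumber s (Q ls)"

definition family_mult ::
  "('d, 'w) family \<Rightarrow> ('d, 'w) family \<Rightarrow> ('d::finite, 'w::ab_group_add) family" where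
  "family_mult A B ls a b w = (\<Sum>c \<in> {c. length c = length ls}. A ls a c (B ls c b w))"

definition linear_entries ::
  "(complex \<Rightarrow> 'w \<Rightarrow> 'w) \<Rightarrow> ('d, 'w::ab_group_add) family \<Rightarrow> bool" where
  "linear_entries s A \<longleftrightarrow> (\<forall>ls a b. ls \<noteq> [] \<longrightarrow> length a = length ls \<longrightarrow> length b = length ls \<longrightarrow>
     Vector_Spaces.linear s s (A ls a b))"

definition disjoint_ordered_sets :: "nat list \<Rightarrow> nat list \<Rightarrow> bool" where
  "disjoint_ordered_sets X Y \<longleftrightarrow>
     X \<noteq> [] \<and> Y \<noteq> [] \<and> distinct X \<and> distinct Y \<and> set X \<inter> set Y = {}"

definition reflection_solutions ::
  "(complex \<Rightarrow> 'w \<Rightarrow> 'w) \<Rightarrow> (complex \<Rightarrow> complex^('d \<times> 'd)^('d \<times> 'd))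
    \<Rightarrow> ('d::finite, 'w::ab_group_add) family \<Rightarrow> bool" where
  "reflection_solutions s R T \<longleftrightarrow> linear_entries s T \<and>
     (\<forall>N M'. disjoint_ordered_sets N M' \<longrightarrow> generically (\<lambda>l.
        fam_at T N l
          \<circ> fused s R (\<lambda>x y. l y + l x) M' N
          \<circ> fam_at T M' l
          \<circ> fused s R (\<lambda>x y. - l x + l y) (rev N) M'
        = fused s R (\<lambda>x y. - l y + l x) M' (rev N)
          \<circ> fam_at T M' l
          \<circ> fused s R (\<lambda>x y. l x + l y) N M'
          \<circ> fam_at T N l))"

text \<open>
  \<open>site_prod s (matrix_inv M) (rev X)\<close> is the inverse of \<open>site_prod s M X\<close> for invertible \<open>M\<close>.
\<close>

definition dual_reflection_solutions ::
  "(complex \<Rightarrow> 'w \<Rightarrow> 'w) \<Rightarrow> (complex \<Rightarrow> complex^('d \<times> 'd)^('d \<times> 'd)) \<Rightarrow> complex^'d^'d \<Rightarrow> complex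
    \<Rightarrow> ('d::finite, 'w::ab_group_add) family \<Rightarrow> bool" where
  "dual_reflection_solutions s R M \<rho> K \<longleftrightarrow> linear_entries s K \<and>
     (\<forall>N M'. disjoint_ordered_sets N M' \<longrightarrow> generically (\<lambda>l.
        fam_at K N l
          \<circ> site_prod s M M'
          \<circ> fused s R (\<lambda>x y. - l y - l x - 2 * \<rho>) (rev M') (rev N)
          \<circ> site_prod s (matrix_inv M) (rev M')
          \<circ> fam_at K M' l
          \<circ> fused s R (\<lambda>x y. l x - l y) N (rev M')
        = fused s R (\<lambda>x y. l y - l x) (rev M') N
          \<circ> fam_at K M' l
          \<circ> site_prod s (matrix_inv M) (rev M')
          \<circ> fused s R (\<lambda>x y. - l x - l y - 2 * \<rho>) (rev N) (rev M')
          \<circ> site_prod s M M'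
          \<circ> fam_at K N l))"

definition commute :: "('d, 'w) lab_op \<Rightarrow> ('d, 'w) lab_op \<Rightarrow> bool" where
  "commute A B \<longleftrightarrow> A \<circ> B = B \<circ> A"

text \<open>
  These are identities between c-number operators, hence stated with the trivial quantum space
  \<open>complex\<close>; \<open>e\<close> is the sign written \<open>\<plusminus>\<close>.
\<close>

definition Q_commutation ::
  "(complex \<Rightarrow> complex^('d \<times> 'd)^('d \<times> 'd)) \<Rightarrow> 'd::finite cfamily \<Rightarrow> bool" where
  "Q_commutation R Q \<longleftrightarrow>
     (\<forall>N M'. disjoint_ordered_sets N M' \<longrightarrow> (\<forall>e \<in> {1, -1}.
        generically (\<lambda>l. commute (fam_at (cnumber_family (*) Q) N l)
                                 (fused (*) R (\<lambda>x y. l y + e * l x) M' N)) \<and>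
        generically (\<lambda>l. commute (fam_at (cnumber_family (*) Q) N l)
                                 (fused (*) R (\<lambda>x y. - l x + e * l y) (rev N) M'))))"

definition S_commutation ::
  "(complex \<Rightarrow> complex^('d \<times> 'd)^('d \<times> 'd)) \<Rightarrow> 'd::finite cfamily \<Rightarrow> bool" where
  "S_commutation R S \<longleftrightarrow>
     (\<forall>N M'. disjoint_ordered_sets N M' \<longrightarrow> (\<forall>e \<in> {1, -1}.
        generically (\<lambda>l. commute (fam_at (cnumber_family (*) S) N l)
                                 (fused (*) R (\<lambda>x y. l x + e * l y) N M')) \<and>
        generically (\<lambda>l. commute (fam_at (cnumber_family (*) S) N l)
                                 (fused (*) R (\<lambda>x y. - l y + e * l x) M' (rev N)))))"

end

theory Submission
  imports Defs
begin

text \<open>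
  Dressing a solution multiplies each side of the (dual) reflection equation by operators \<open>Q\<^sub>N\<close> and
  \<open>Q\<^sub>M'\<close>. They commute with each other and with the solutions on the other label set, so the
  equation survives as soon as they can be moved past the \<open>R\<close>-matrices to a common end of both sides
  (\<open>dress_right\<close>, \<open>dress_left\<close>). For the reflection equation the hypotheses on \<open>Q\<close> and \<open>S\<close> give
  exactly the required commutation relations, used for the pair \<open>N\<close>, \<open>M'\<close>, for the exchanged pair
  and for reversed lists.

  In the dual equation two of the \<open>R\<close>-matrices occur conjugated by \<open>M\<close> and at the shifted argument
  \<open>-\<lambda>\<^sub>N - \<lambda>\<^sub>M' - 2\<rho>\<close>, about which the hypotheses say nothing directly. Crossing-unitarity says that
  such a matrix is, up to a scalar, the crossed inverse of the \<open>R\<close>-matrix at \<open>\<lambda>\<^sub>N + \<lambda>\<^sub>M'\<close>: transpose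
  in one of the two spaces, invert, transpose back. An operator on one of the spaces that commutes
  with a matrix also commutes with its crossed inverse (\<open>commute_crossed_inverse\<close>). For fused
  matrices, the crossed inverse is taken factor by factor, and the reversals of order cause the
  reversed label lists.

  To avoid partial transposes of operators on many spaces, the proof works with the second
  multiplication on operators in which the second space is multiplied in the opposite order
  (\<open>mixed\<close>). An operator on the first space multiplies the same way in both, one on the second space
  with the two sides exchanged; in either case commuting with it means the same for both
  multiplications. In the second multiplication the crossed inverse is an ordinary inverse.

  The remaining ingredients are the transfer of identities between c-number operators to an
  arbitrary quantum space by linear functionals (\<open>commute_transfer\<close>), and the fact that a property
  generic in one complex variable is generic in \<open>\<lambda>\<^sub>x + \<lambda>\<^sub>y\<close> (\<open>generically_label_sum\<close>).
\<close>

section \<open>Operators placed on labels\<close>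

definition agree :: "'l set \<Rightarrow> ('l \<Rightarrow> 'd) \<Rightarrow> ('l \<Rightarrow> 'd) set" where
  "agree X c = {c'. \<forall>x. x \<notin> X \<longrightarrow> c' x = c x}"

lemma agree_eq_override: "agree X c = (\<lambda>g. override_on c g X) ` (X \<rightarrow>\<^sub>E UNIV)"
proof -
  have "c' = override_on c (restrict c' X) X" if "c' \<in> agree X c" for c'
    using that by (auto simp: agree_def override_on_def)
  then have "agree X c \<subseteq> (\<lambda>g. override_on c g X) ` (X \<rightarrow>\<^sub>E UNIV)"
    by (metis (no_types, lifting) UNIV_I image_eqI restrict_PiE_iff subsetI)
  then show ?thesis by (auto simp: agree_def)
qed

lemma finite_agree [simp]: "finite X \<Longrightarrow> finite (agree X (c :: 'l \<Rightarrow> 'd::finite))"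
  unfolding agree_eq_override by (intro finite_imageI finite_PiE) auto

lemma agree_cong: "c' \<in> agree X c \<Longrightarrow> agree X c' = agree X c"
  by (auto simp: agree_def)

lemma bij_betw_agree_lists:
  assumes "distinct X"
  shows "bij_betw (\<lambda>c'. map c' X) (agree (set X) c) {l. length l = length X}"
proof (rule bij_betw_imageI)
  show "inj_on (\<lambda>c'. map c' X) (agree (set X) c)"
    by (rule inj_onI, rule ext) (auto simp: agree_def)
  have "\<exists>c'\<in>agree (set X) c. map c' X = l" if "length l = length X" for l
  proof
    let ?c = "\<lambda>x. if x \<in> set X then the (map_of (zip X l) x) else c x"
    show "?c \<in> agree (set X) c" by (auto simp: agree_def)
    show "map ?c X = l"
      using assms that by (intro nth_equalityI) (auto simp: map_of_zip_nth)
  qed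
  then show "(\<lambda>c'. map c' X) ` agree (set X) c = {l. length l = length X}"
    by (auto simp: image_iff)
qed

lemma place_agree: "place X A f c = (\<Sum>c' \<in> agree (set X) c. A (map c X) (map c' X) (f c'))"
  by (simp add: place_def agree_def)

lemma sum_agree_single: "sum g (agree {x} c) = (\<Sum>k\<in>UNIV. g (c(x := k)))"
proof -
  have "agree {x} c = range (\<lambda>k. c(x := k))"
    by (auto simp: agree_def image_iff fun_eq_iff)
  moreover have "inj (\<lambda>k. c(x := k))" by (rule injI) (metis fun_upd_same)
  ultimately show ?thesis by (simp add: sum.reindex)
qed

lemma sum_agree_pair:
  assumes "x \<noteq> y"
  shows "sum g (agree {x, y} c) = (\<Sum>(k, m)\<in>UNIV. g (c(x := k, y := m)))"
proof (rule sum.reindex_bij_witness[of _ "\<lambda>(k, m). c(x := k, y := m)" "\<lambda>c'. (c' x, c' y)"])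
  fix c' assume "c' \<in> agree {x, y} c"
  then have *: "c(x := c' x, y := c' y) = c'" by (auto simp: agree_def)
  then show "(case (c' x, c' y) of (k, m) \<Rightarrow> c(x := k, y := m)) = c'" by simp
  show "(case (c' x, c' y) of (k, m) \<Rightarrow> g (c(x := k, y := m))) = g c'" by (simp add: *)
qed (use assms in \<open>auto simp: agree_def\<close>)

lemma on_site_apply: "on_site s B x f c = (\<Sum>k\<in>UNIV. s (B $ c x $ k) (f (c(x := k))))"
  by (simp add: on_site_def place_agree sum_agree_single cnumber_def)

lemma on_sites_apply:
  "x \<noteq> y \<Longrightarrow> on_sites s A x y f c
    = (\<Sum>(k, m)\<in>UNIV. s (A $ (c x, c y) $ (k, m)) (f (c(x := k, y := m))))"
  by (auto simp: on_sites_def place_agree sum_agree_pair cnumber_def intro!: sum.cong)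

lemma flip_nth [simp]: "flip A $ i $ k = A $ (snd i, fst i) $ (snd k, fst k)"
proof -
  have *: "(\<Sum>p\<in>UNIV. (if fst p = snd k \<and> snd p = fst k then 1 else 0) * h p) = (h (snd k, fst k) :: complex)"
    for h :: "'a \<times> 'a \<Rightarrow> complex" and k
  proof -
    have "(\<Sum>p\<in>UNIV. (if fst p = snd k \<and> snd p = fst k then 1 else 0) * h p)
       = (\<Sum>p\<in>UNIV. if p = (snd k, fst k) then h p else 0)"
      by (rule sum.cong) (auto simp: prod_eq_iff)
    then show ?thesis by simp
  qed
  have **: "(if fst i = snd p \<and> snd i = fst p then 1 else 0)
     = (if fst p = snd i \<and> snd p = fst i then 1 else (0::complex))" for p i :: "'a \<times> 'a"
    by auto
  show ?thesis
    unfolding flip_def permutation_matrix_def matrix_matrix_mult_def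
    by (simp add: ** * mult.commute[of _ "if _ then _ else _"])
qed

lemma on_sites_flip: "x \<noteq> y \<Longrightarrow> on_sites s (flip A) x y = on_sites s A y x"
proof (intro ext)
  fix f c assume "x \<noteq> y"
  have "(\<Sum>(k, m)\<in>UNIV. h k m) = (\<Sum>(m, k)\<in>UNIV. h k m)" for h :: "'a \<Rightarrow> 'a \<Rightarrow> 'b"
    by (rule sum.reindex_bij_witness[of _ prod.swap prod.swap]) auto
  with \<open>x \<noteq> y\<close> show "on_sites s (flip A) x y f c = on_sites s A y x f c"
    by (simp add: on_sites_apply fun_upd_twist)
qed

locale quantum_space = vector_space s for s :: "complex \<Rightarrow> 'w::ab_group_add \<Rightarrow> 'w"
begin

text \<open>
  The type of operators contains all maps, and composition with an operator on the left distributes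
  over sums only if the operator is linear.
\<close>

definition linop :: "('d, 'w) lab_op \<Rightarrow> bool" where
  "linop H \<longleftrightarrow> (\<forall>f g. H (\<lambda>c. f c + g c) = (\<lambda>c. H f c + H g c)) \<and>
     (\<forall>k f. H (\<lambda>c. s k (f c)) = (\<lambda>c. s k (H f c)))"

lemma linop_id: "linop id" by (simp add: linop_def)

lemma linop_comp: "linop G \<Longrightarrow> linop H \<Longrightarrow> linop (G \<circ> H)"
  by (simp add: linop_def)

lemma linop_add: "linop H \<Longrightarrow> H (\<lambda>c. f c + g c) = (\<lambda>c. H f c + H g c)"
  and linop_scale: "linop H \<Longrightarrow> H (\<lambda>c. s k (f c)) = (\<lambda>c. s k (H f c))"
  by (simp_all add: linop_def)

lemma linop_sum:
  assumes "linop H" "finite I"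
  shows "H (\<lambda>c. \<Sum>i\<in>I. F i c) = (\<lambda>c. \<Sum>i\<in>I. H (F i) c)"
  using assms(2)
proof induction
  case empty
  show ?case using linop_scale[OF assms(1), of 0 "\<lambda>c. 0"] by simp
next
  case (insert i I)
  with linop_add[OF assms(1), of "F i" "\<lambda>c. \<Sum>i\<in>I. F i c"] show ?case by simp
qed

abbreviation linmap :: "('w \<Rightarrow> 'w) \<Rightarrow> bool" where
  "linmap \<equiv> Vector_Spaces.linear s s"

lemma linmap_iff: "linmap g \<longleftrightarrow> (\<forall>v w. g (v + w) = g v + g w) \<and> (\<forall>k w. g (s k w) = s k (g w))"
  using vector_space_axioms module_axioms
  by (auto simp: Vector_Spaces.linear_def module_hom_def module_hom_axioms_def)

lemma linmap_sum: "linmap g \<Longrightarrow> g (sum h I) = (\<Sum>i\<in>I. g (h i))"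
  unfolding Vector_Spaces.linear_def using module_hom.sum by blast

lemma linmap_scale_const: "linmap (s k)"
  by (simp add: linmap_iff scale_right_distrib mult.commute)

definition linmat :: "nat \<Rightarrow> ('d list \<Rightarrow> 'd list \<Rightarrow> 'w \<Rightarrow> 'w) \<Rightarrow> bool" where
  "linmat n A \<longleftrightarrow> (\<forall>a b. length a = n \<longrightarrow> length b = n \<longrightarrow> linmap (A a b))"

lemma linmatD: "linmat (length X) A \<Longrightarrow> linmap (A (map c X) (map c' X))"
  by (simp add: linmat_def)

lemma linmat_cnumber: "linmat n (cnumber s A)"
  by (simp add: linmat_def cnumber_def linmap_scale_const)

lemma linop_place:
  assumes "linmat (length X) A"
  shows "linop (place X A)"
  using linmatD[OF assms] unfolding linop_def place_agree linmap_iff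
  by (simp add: sum.distrib scale_sum_right)

lemma linop_on_site: "linop (on_site s B x)"
  unfolding on_site_def by (intro linop_place linmat_cnumber)

lemma linop_on_sites: "linop (on_sites s B x y)"
  unfolding on_sites_def by (intro linop_place linmat_cnumber)

text \<open>
  Needed to read \<open>fam_at\<close> of a product family as a composition. Distinctness of the labels makes the
  intermediate configurations correspond to the intermediate index lists; linearity of the left
  factor lets its entries pass through the sum in the right one.
\<close>

lemma place_comp_place:
  assumes "distinct X" "linmat (length X) A"
  shows "place X A \<circ> place X B
    = place X (\<lambda>a b w. \<Sum>c\<in>{c. length c = length X}. A a c (B c b w))"
proof (intro ext)
  fix f c
  note lin = linmap_sum[OF linmatD[OF assms(2)]]
  let ?h = "\<lambda>c'' l. A (map c X) l (B l (map c'' X) (f c''))"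
  have "(place X A \<circ> place X B) f c
      = (\<Sum>c' \<in> agree (set X) c. \<Sum>c''\<in>agree (set X) c. ?h c'' (map c' X))"
    unfolding o_def place_agree[of X A] place_agree[of X B]
    by (intro sum.cong refl) (simp add: lin agree_cong[where c=c])
  also have "\<dots> = (\<Sum>c''\<in>agree (set X) c. \<Sum>c' \<in> agree (set X) c. ?h c'' (map c' X))"
    by (rule sum.swap)
  also have "\<dots> = (\<Sum>c''\<in>agree (set X) c. \<Sum>l | length l = length X. ?h c'' l)"
    by (intro sum.cong refl sum.reindex_bij_betw[OF bij_betw_agree_lists[OF assms(1)]])
  finally show "(place X A \<circ> place X B) f c
      = place X (\<lambda>a b w. \<Sum>c\<in>{c. length c = length X}. A a c (B c b w)) f c"
    by (simp add: place_agree)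
qed

text \<open>
  Operators on disjoint label sets change disjoint coordinates of a configuration, so the two sums
  can be performed in either order; what remains is the commutation of the entries on the quantum
  space.
\<close>

lemma commute_place:
  assumes disj: "set X \<inter> set Y = {}" and A: "linmat (length X) A" and B: "linmat (length Y) B"
    and AB: "\<And>a a' b b' w. length a = length X \<Longrightarrow> length a' = length X \<Longrightarrow>
      length b = length Y \<Longrightarrow> length b' = length Y \<Longrightarrow> A a a' (B b b' w) = B b b' (A a a' w)"
  shows "commute (place X A) (place Y B)"
proof -
  have disj': "set Y \<inter> set X = {}" using disj by blast
  have mo: "map (override_on c d (set Z)) Z = map d Z" for c d :: "nat \<Rightarrow> 'a" and Z
    by (simp)
  have shift: "place Z F f c' = (\<Sum>d\<in>agree (set Z) c.
        F (map c Z) (map d Z) (f (override_on c' d (set Z))))"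
    if c': "c' \<in> agree (set W) c" and WZ: "set W \<inter> set Z = {}"
    for W Z and F :: "'a list \<Rightarrow> 'a list \<Rightarrow> 'w \<Rightarrow> 'w" and f and c c' :: "nat \<Rightarrow> 'a"
  proof -
    have "map c' Z = map c Z" using c' WZ by (auto simp: agree_def)
    moreover have "sum g (agree (set Z) c') = (\<Sum>d\<in>agree (set Z) c. g (override_on c' d (set Z)))"
      for g :: "(nat \<Rightarrow> 'a) \<Rightarrow> 'w"
      by (rule sum.reindex_bij_witness[of _ "\<lambda>d. override_on c' d (set Z)" "\<lambda>d. override_on c d (set Z)"])
        (auto simp: agree_def override_on_def fun_eq_iff intro!: arg_cong[where f=g])
    ultimately show ?thesis by (simp only: place_agree mo)
  qed
  have ov: "override_on d c' (set X) = override_on c' d (set Y)"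
    if "c' \<in> agree (set X) c" "d \<in> agree (set Y) c" for c c' d :: "nat \<Rightarrow> 'a"
    using that disj by (auto simp: agree_def override_on_def fun_eq_iff)
  show ?thesis
    unfolding commute_def
  proof (intro ext)
    fix f c
    have "(place X A \<circ> place Y B) f c = (\<Sum>c'\<in>agree (set X) c. \<Sum>d\<in>agree (set Y) c.
        A (map c X) (map c' X) (B (map c Y) (map d Y) (f (override_on c' d (set Y)))))"
      unfolding o_def place_agree[of X A]
      by (rule sum.cong) (simp_all add: shift[OF _ disj] linmap_sum[OF linmatD[OF A]])
    also have "\<dots> = (\<Sum>d\<in>agree (set Y) c. \<Sum>c'\<in>agree (set X) c.
        B (map c Y) (map d Y) (A (map c X) (map c' X) (f (override_on d c' (set X)))))"
      by (subst sum.swap) (simp add: AB ov)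
    also have "\<dots> = (place Y B \<circ> place X A) f c"
      unfolding o_def place_agree[of Y B]
      by (rule sum.cong) (simp_all add: shift[OF _ disj'] linmap_sum[OF linmatD[OF B]])
    finally show "(place X A \<circ> place Y B) f c = (place Y B \<circ> place X A) f c" .
  qed
qed

lemma commute_place_cnumber:
  assumes "set X \<inter> set Y = {}" "linmat (length Y) B"
  shows "commute (place X (cnumber s A)) (place Y B)"
  by (rule commute_place[OF assms(1) linmat_cnumber assms(2)])
    (use assms(2) in \<open>simp add: linmat_def cnumber_def linmap_iff\<close>)

end

section \<open>Products of operators on sites\<close>

lemma commute_sym: "commute A B \<Longrightarrow> commute B A"
  by (simp add: commute_def)

lemma commute_id: "commute A id"
  by (simp add: commute_def)

lemma commute_comp: "commute A B \<Longrightarrow> commute A C \<Longrightarrow> commute A (B \<circ> C)"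
  unfolding commute_def by (metis comp_assoc)

lemma commuteD: "commute A B \<Longrightarrow> A (B f) = B (A f)"
  by (metis commute_def comp_apply)

lemma op_prod_simps [simp]: "op_prod [] = id" "op_prod (A # As) = A \<circ> op_prod As"
  by (simp_all add: op_prod_def)

lemma op_prod_append [simp]: "op_prod (As @ Bs) = op_prod As \<circ> op_prod Bs"
  by (induction As) (auto simp: comp_assoc)

lemma commute_op_prod: "(\<And>B. B \<in> set Bs \<Longrightarrow> commute A B) \<Longrightarrow> commute A (op_prod Bs)"
  by (induction Bs) (auto intro: commute_id commute_comp)

lemma sum_UNIV_pair: "(\<Sum>p\<in>UNIV. g p) = (\<Sum>j\<in>UNIV. \<Sum>m\<in>UNIV. g (j, m))"
  by (simp add: sum.cartesian_product)

definition matrix_unit :: "'d \<times> 'd \<Rightarrow> complex^'d^'d" where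
  "matrix_unit p = (\<chi> i k. if (i, k) = p then 1 else 0)"

text \<open>
  The second tensor factor is expanded in matrix units: \<open>A = (\<Sum>p. block A p \<otimes> matrix_unit p)\<close>.
\<close>

definition block :: "complex^('d::finite \<times> 'd)^('d \<times> 'd) \<Rightarrow> 'd \<times> 'd \<Rightarrow> complex^'d^'d" where
  "block A p = (\<chi> i k. A $ (i, fst p) $ (k, snd p))"

text \<open>
  The order of the factors in a fused \<open>R\<close>-matrix: the second label is the outer loop.
\<close>

definition label_pairs :: "'l list \<Rightarrow> 'l list \<Rightarrow> ('l \<times> 'l) list" where
  "label_pairs X Y = concat (map (\<lambda>y. map (\<lambda>x. (x, y)) X) Y)"

lemma set_label_pairs [simp]: "set (label_pairs X Y) = set X \<times> set Y"
  by (auto simp: label_pairs_def)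

lemma rev_label_pairs: "rev (label_pairs X Y) = label_pairs (rev X) (rev Y)"
  by (induction Y) (auto simp: label_pairs_def rev_map)

lemma label_pairs_Nil [simp]: "label_pairs X [] = []"
  and label_pairs_Cons: "label_pairs X (y # Y) = map (\<lambda>x. (x, y)) X @ label_pairs X Y"
  by (simp_all add: label_pairs_def)

context quantum_space
begin

lemma on_site_unit:
  "on_site s (matrix_unit (j, m)) y f c = (if c y = j then f (c(y := m)) else 0)"
proof -
  have "s (matrix_unit (j, m) $ c y $ k) v = (if k = m then if c y = j then v else 0 else 0)" for k v
    by (simp add: matrix_unit_def)
  then show ?thesis by (simp add: on_site_apply)
qed

lemma on_sites_expand:
  assumes "x \<noteq> y"
  shows "on_sites s A x y f
    = (\<lambda>c. \<Sum>p\<in>UNIV. on_site s (block A p) x (on_site s (matrix_unit p) y f) c)"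
proof
  fix c
  have "(\<Sum>p\<in>UNIV. on_site s (block A p) x (on_site s (matrix_unit p) y f) c)
    = (\<Sum>j\<in>UNIV. \<Sum>m\<in>UNIV. if j = c y then \<Sum>k\<in>UNIV. s (A $ (c x, j) $ (k, m)) (f (c(x := k, y := m))) else 0)"
    unfolding sum_UNIV_pair
    by (intro sum.cong refl) (use assms in \<open>auto simp: on_site_apply[where x=x] on_site_unit block_def\<close>)
  also have "\<dots> = (\<Sum>m\<in>UNIV. \<Sum>k\<in>UNIV. s (A $ (c x, c y) $ (k, m)) (f (c(x := k, y := m))))"
    by (subst sum.swap) simp
  also have "\<dots> = on_sites s A x y f c"
    using assms by (simp add: on_sites_apply sum_UNIV_pair) (rule sum.swap)
  finally show "on_sites s A x y f c
    = (\<Sum>p\<in>UNIV. on_site s (block A p) x (on_site s (matrix_unit p) y f) c)" by simp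
qed

lemma on_site_sum: "on_site s (\<Sum>i\<in>I. B i) x f c = (\<Sum>i\<in>I. on_site s (B i) x f c)"
  unfolding on_site_apply by (simp add: scale_sum_left) (rule sum.swap)

lemma on_site_mult: "on_site s B x (on_site s C x f) = on_site s (B ** C) x f"
proof
  fix c
  show "on_site s B x (on_site s C x f) c = on_site s (B ** C) x f c"
    unfolding on_site_apply matrix_matrix_mult_def
    by (simp add: scale_sum_left scale_sum_right) (rule sum.swap)
qed

lemma on_site_one: "on_site s (mat 1) x f = f"
proof
  fix c
  have "s ((mat 1 :: complex^'a^'a) $ c x $ k) v = (if k = c x then v else 0)" for k v
    by (simp add: mat_def)
  then show "on_site s (mat 1) x f c = f c" by (simp add: on_site_apply)
qed

lemma on_site_0: "on_site s 0 x f = (\<lambda>c. 0)"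
  by (simp add: on_site_apply fun_eq_iff)

lemma on_sites_mult:
  assumes "x \<noteq> y"
  shows "on_sites s A x y (on_sites s B x y f) = on_sites s (A ** B) x y f"
proof
  fix c
  have *: "s (A $ (c x, c y) $ (k, m)) (\<Sum>(k', m')\<in>UNIV.
      s (B $ ((c(x := k, y := m)) x, (c(x := k, y := m)) y) $ (k', m'))
        (f (c(x := k, y := m, x := k', y := m'))))
    = (\<Sum>q\<in>UNIV. s (A $ (c x, c y) $ (k, m) * B $ (k, m) $ q) (f (c(x := fst q, y := snd q))))" for k m
    using assms by (simp add: scale_sum_right case_prod_unfold fun_upd_twist)
  show "on_sites s A x y (on_sites s B x y f) c = on_sites s (A ** B) x y f c"
    unfolding on_sites_apply[OF assms] * matrix_matrix_mult_def
    by (simp add: scale_sum_left case_prod_unfold) (rule sum.swap)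
qed

lemma on_sites_scale:
  "x \<noteq> y \<Longrightarrow> on_sites s (\<chi> i j. k * A $ i $ j) x y f = (\<lambda>c. s k (on_sites s A x y f c))"
  by (auto simp: on_sites_apply fun_eq_iff scale_sum_right case_prod_unfold)

lemma on_site_eq_on_sites:
  assumes "x \<noteq> y"
  shows "on_site s B x = on_sites s (tensor B (mat 1)) x y"
proof (intro ext)
  fix f c
  have "s (tensor B (mat 1) $ (c x, c y) $ (k, m)) v = (if m = c y then s (B $ c x $ k) v else 0)" for k m v
    by (simp add: tensor_def mat_def)
  moreover have "c(x := k, y := c y) = c(x := k)" for k using assms by auto
  ultimately show "on_site s B x f c = on_sites s (tensor B (mat 1)) x y f c"
    using assms by (simp add: on_sites_apply on_site_apply sum_UNIV_pair)
qed

lemma commute_on_site: "x \<noteq> y \<Longrightarrow> commute (on_site s B x) (on_site s C y)"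
  unfolding on_site_def by (rule commute_place_cnumber) (simp_all add: linmat_cnumber)

lemma commute_on_sites:
  "{x, y} \<inter> {x', y'} = {} \<Longrightarrow> commute (on_sites s A x y) (on_sites s B x' y')"
  unfolding on_sites_def by (rule commute_place_cnumber) (simp_all add: linmat_cnumber)

section \<open>Multiplication with the second tensor factor reversed\<close>

text \<open>
  Commuting with all matrices on the site \<open>z\<close> expresses that \<open>z\<close> is not among the labels on which
  the operator acts; in this form no explicit support has to be carried along.
\<close>

definition trivial_at :: "('d::finite, 'w) lab_op \<Rightarrow> nat \<Rightarrow> bool" where
  "trivial_at H z \<longleftrightarrow> (\<forall>C. commute H (on_site s C z))"

lemma trivial_atD: "trivial_at H z \<Longrightarrow> H (on_site s C z f) = on_site s C z (H f)"
  by (simp add: trivial_at_def commuteD)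

lemma trivial_at_comp: "trivial_at G z \<Longrightarrow> trivial_at H z \<Longrightarrow> trivial_at (G \<circ> H) z"
  unfolding trivial_at_def by (metis commute_comp commute_sym)

lemma trivial_at_id: "trivial_at id z"
  by (simp add: trivial_at_def commute_def)

lemma trivial_at_on_sites: "z \<noteq> x \<Longrightarrow> z \<noteq> y \<Longrightarrow> trivial_at (on_sites s A x y) z"
  unfolding trivial_at_def on_sites_def on_site_def
  by (intro allI commute_place_cnumber) (simp_all add: linmat_cnumber)

lemma trivial_at_place:
  assumes "z \<notin> set X" "linmat (length X) A"
  shows "trivial_at (place X A) z"
  unfolding trivial_at_def on_site_def
  by (intro allI commute_sym[OF commute_place_cnumber]) (use assms in auto)

text \<open>
  Left multiplication of \<open>H\<close> by \<open>A\<close>, except that the second tensor factor of \<open>A\<close> multiplies \<open>H\<close> from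
  the right: \<open>(\<Sum>i. a\<^sub>i \<otimes> b\<^sub>i)\<close> sends \<open>H\<close> to \<open>(\<Sum>i. a\<^sub>i \<circ> H \<circ> b\<^sub>i)\<close>. This is how multiplication looks
  after a partial transposition in the second space, and it replaces partial transposition of
  operators.
\<close>

definition mixed ::
  "complex^('d::finite \<times> 'd)^('d \<times> 'd) \<Rightarrow> nat \<Rightarrow> nat \<Rightarrow> ('d, 'w) lab_op \<Rightarrow> ('d, 'w) lab_op" where
  "mixed A x y H = (\<lambda>f c. \<Sum>p\<in>UNIV. on_site s (block A p) x (H (on_site s (matrix_unit p) y f)) c)"

lemma linop_mixed: "linop H \<Longrightarrow> linop (mixed A x y H)"
  by (subst linop_def) (simp add: mixed_def linop_add[OF linop_on_site] linop_scale[OF linop_on_site]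
      linop_add linop_scale sum.distrib scale_sum_right)

lemma mixed_trivial_right:
  assumes "x \<noteq> y" "trivial_at H y"
  shows "mixed A x y H = on_sites s A x y \<circ> H"
  by (simp add: fun_eq_iff mixed_def on_sites_expand[OF assms(1)] trivial_atD[OF assms(2)])

lemma mixed_comp_right:
  assumes "trivial_at Q y"
  shows "mixed A x y (H \<circ> Q) = mixed A x y H \<circ> Q"
  by (simp add: fun_eq_iff mixed_def trivial_atD[OF assms])

lemma mixed_comp_left:
  assumes "trivial_at Q x" "linop Q"
  shows "mixed A x y (Q \<circ> H) = Q \<circ> mixed A x y H"
  by (simp add: fun_eq_iff mixed_def trivial_atD[OF assms(1), symmetric] linop_sum[OF assms(2)])

lemma mixed_commute:
  assumes "x \<noteq> x'" "y \<noteq> y'"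
  shows "mixed A x y (mixed B x' y' H) = mixed B x' y' (mixed A x y H)"
proof (intro ext)
  fix f c
  have 1: "on_site s C x (on_site s C' x' g) = on_site s C' x' (on_site s C x g)"
    for C C' :: "complex^'a^'a" and g
    by (rule commuteD[OF commute_on_site[OF assms(1)]])
  have 2: "on_site s C y (on_site s C' y' g) = on_site s C' y' (on_site s C y g)"
    for C C' :: "complex^'a^'a" and g
    by (rule commuteD[OF commute_on_site[OF assms(2)]])
  have "mixed A x y (mixed B x' y' H) f c = (\<Sum>p\<in>UNIV. \<Sum>q\<in>UNIV. on_site s (block A p) x
      (on_site s (block B q) x' (H (on_site s (matrix_unit q) y' (on_site s (matrix_unit p) y f)))) c)"
    by (simp add: mixed_def linop_sum[OF linop_on_site])
  also have "\<dots> = (\<Sum>q\<in>UNIV. \<Sum>p\<in>UNIV. on_site s (block B q) x'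
      (on_site s (block A p) x (H (on_site s (matrix_unit p) y (on_site s (matrix_unit q) y' f)))) c)"
    by (subst sum.swap) (simp add: 1 2)
  also have "\<dots> = mixed B x' y' (mixed A x y H) f c"
    by (simp add: mixed_def linop_sum[OF linop_on_site])
  finally show "mixed A x y (mixed B x' y' H) f c = mixed B x' y' (mixed A x y H) f c" .
qed

text \<open>
  Transposition reverses products, so multiplying the second factors in the reversed order amounts
  to ordinary multiplication of the matrices transposed in the second space.
\<close>

lemma mixed_inverse:
  fixes A B :: "complex^('d::finite \<times> 'd)^('d \<times> 'd)"
  assumes AB: "transpose2 A ** transpose2 B = mat 1" and H: "linop H"
  shows "mixed A x y (mixed B x y H) = H"
proof (intro ext)
  fix f c
  have unit: "matrix_unit (r, t) ** matrix_unit (j, m) = (if t = j then matrix_unit (r, m) else 0)"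
    for r t j m :: 'd
  proof -
    have "(\<Sum>k\<in>UNIV. (if i = r \<and> k = t then 1 else 0) * (if k = j \<and> l = m then 1 else 0))
      = (\<Sum>k\<in>UNIV. if k = t then (if i = r \<and> t = j \<and> l = m then 1 else (0::complex)) else 0)" for i l :: 'd
      by (rule sum.cong) auto
    then show ?thesis
      by (simp add: matrix_unit_def matrix_matrix_mult_def vec_eq_iff)
  qed
  have blocks: "(\<Sum>j\<in>UNIV. block A (j, m) ** block B (r, j)) = (if r = m then mat 1 else 0)" for m r
  proof -
    have "(\<Sum>j\<in>UNIV. \<Sum>k\<in>UNIV. A $ (i, j) $ (k, m) * B $ (k, r) $ (l, j))
        = mat 1 $ (i, m) $ (l, r)" for i l
      unfolding AB[symmetric]
      by (simp add: matrix_matrix_mult_def transpose2_def sum_UNIV_pair) (rule sum.swap)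
    then have "(\<Sum>j\<in>UNIV. block A (j, m) ** block B (r, j)) $ i $ l = mat 1 $ (i, m) $ (l, r)" for i l
      by (simp add: block_def matrix_matrix_mult_def sum_component)
    then show ?thesis by (auto simp: vec_eq_iff mat_def)
  qed
  \<comment> \<open>On \<open>y\<close> the outer factor \<open>p\<close> is applied first, so the matrix units multiply in the order \<open>q\<close>, \<open>p\<close>.\<close>
  have "mixed A x y (mixed B x y H) f c = (\<Sum>p\<in>UNIV. \<Sum>q\<in>UNIV. on_site s (block A p ** block B q) x
      (H (on_site s (matrix_unit q ** matrix_unit p) y f)) c)"
    by (simp add: mixed_def linop_sum[OF linop_on_site] on_site_mult)
  also have "\<dots> = (\<Sum>j\<in>UNIV. \<Sum>m\<in>UNIV. \<Sum>r\<in>UNIV. on_site s (block A (j, m) ** block B (r, j)) x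
      (H (on_site s (matrix_unit (r, m)) y f)) c)"
  proof -
    have "(\<Sum>t\<in>UNIV. on_site s (block A (j, m) ** block B (r, t)) x
        (H (on_site s (if t = j then matrix_unit (r, m) else 0) y f)) c)
      = (\<Sum>t\<in>UNIV. if t = j then on_site s (block A (j, m) ** block B (r, j)) x
        (H (on_site s (matrix_unit (r, m)) y f)) c else 0)" for j m r
    proof (rule sum.cong)
      have "H (\<lambda>c. 0) = (\<lambda>c. 0)" using linop_sum[OF H, of "{}"] by simp
      moreover have "on_site s C x (\<lambda>c. 0) c = 0" for C by (simp add: on_site_apply)
      ultimately show "on_site s (block A (j, m) ** block B (r, t)) x
        (H (on_site s (if t = j then matrix_unit (r, m) else 0) y f)) c
        = (if t = j then on_site s (block A (j, m) ** block B (r, j)) x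
        (H (on_site s (matrix_unit (r, m)) y f)) c else 0)" for t
        by (simp add: on_site_0)
    qed simp
    then show ?thesis by (simp add: sum_UNIV_pair unit)
  qed
  also have "\<dots> = (\<Sum>m\<in>UNIV. \<Sum>r\<in>UNIV. on_site s (\<Sum>j\<in>UNIV. block A (j, m) ** block B (r, j)) x
      (H (on_site s (matrix_unit (r, m)) y f)) c)"
    unfolding on_site_sum by (subst sum.swap, rule sum.cong[OF refl], subst sum.swap) (rule refl)
  also have "\<dots> = (\<Sum>m\<in>UNIV. \<Sum>r\<in>UNIV. if r = m then H (on_site s (matrix_unit (r, m)) y f) c else 0)"
    by (intro sum.cong refl) (simp add: blocks on_site_one on_site_0)
  also have "\<dots> = H (\<lambda>c. \<Sum>m\<in>UNIV. on_site s (matrix_unit (m, m)) y f c) c"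
    by (simp add: linop_sum[OF H])
  also have "(\<lambda>c. \<Sum>m\<in>UNIV. on_site s (matrix_unit (m, m)) y f c) = f"
    by (simp add: on_site_unit fun_eq_iff)
  finally show "mixed A x y (mixed B x y H) f c = H f c" .
qed

end

lemma transpose_transpose1:
  "transpose (transpose1 A) = transpose2 A"
  by (simp add: transpose_def transpose1_def transpose2_def vec_eq_iff)

lemma flip_mult: "flip (A ** B) = flip A ** flip B"
proof -
  have "(\<Sum>q\<in>UNIV. h q) = (\<Sum>q\<in>UNIV. h (snd q, fst q))" for h :: "'a \<times> 'a \<Rightarrow> complex"
    by (rule sum.reindex_bij_witness[of _ prod.swap prod.swap]) auto
  note swap = this
  have "(\<Sum>q\<in>UNIV. A $ i $ q * B $ q $ j) = (\<Sum>q\<in>UNIV. A $ i $ (snd q, fst q) * B $ (snd q, fst q) $ j)" for i j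
    by (rule swap)
  then show ?thesis by (simp add: vec_eq_iff matrix_matrix_mult_def)
qed

lemma flip_mat_one: "flip (mat 1) = mat 1"
  by (auto simp: vec_eq_iff mat_def)

lemma flip_flip: "flip (flip A) = A"
  by (simp add: vec_eq_iff)

lemma transpose2_flip: "transpose2 (flip A) = flip (transpose (transpose2 A))"
  by (simp add: transpose_def transpose2_def vec_eq_iff)

text \<open>
  The two partial transposes of a matrix are total transposes of each other, and a one-sided inverse
  of a square matrix is two-sided; hence the crossed inverse relation does not depend on which of
  the two spaces is transposed.
\<close>

lemma transpose2_inverse_flip:
  assumes "transpose2 A ** transpose2 B = mat 1"
  shows "transpose2 (flip A) ** transpose2 (flip B) = mat 1"
proof -
  have "transpose2 (flip A) ** transpose2 (flip B) = flip (transpose (transpose2 B ** transpose2 A))"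
    by (simp add: transpose2_flip flip_mult matrix_transpose_mul)
  also have "transpose2 B ** transpose2 A = mat 1"
    using assms by (simp add: matrix_left_right_inverse)
  finally show ?thesis by (simp add: transpose_mat flip_mat_one)
qed

lemma fused_eq_op_prod:
  "fused s R g X Y = op_prod (map (\<lambda>(x, y). on_sites s (R (g x y)) x y) (label_pairs X Y))"
  by (simp add: fused_def label_pairs_def map_concat o_def)

lemma op_prod_interleave:
  assumes "distinct Y"
    and "\<And>y y'. y \<in> set Y \<Longrightarrow> y' \<in> set Y \<Longrightarrow> y \<noteq> y' \<Longrightarrow> commute (B y) (A y')"
  shows "op_prod (map (\<lambda>y. A y \<circ> B y) Y) = op_prod (map A Y) \<circ> op_prod (map B Y)"
  using assms
proof (induction Y)
  case (Cons y Y)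
  have "commute (B y) (op_prod (map A Y))"
    using Cons.prems by (intro commute_op_prod) auto
  then have *: "B y \<circ> op_prod (map A Y) = op_prod (map A Y) \<circ> B y"
    by (simp add: commute_def)
  have "op_prod (map (\<lambda>y. A y \<circ> B y) (y # Y))
      = A y \<circ> (B y \<circ> op_prod (map A Y)) \<circ> op_prod (map B Y)"
    using Cons.prems by (subst list.map, subst op_prod_simps, subst Cons.IH) (auto simp: comp_assoc)
  also have "\<dots> = op_prod (map A (y # Y)) \<circ> op_prod (map B (y # Y))"
    unfolding * by (simp add: comp_assoc)
  finally show ?case .
qed simp

lemma op_prod_label_pairs:
  "op_prod (map (\<lambda>(x, y). F x y) (label_pairs X Y)) = op_prod (map (\<lambda>y. op_prod (map (\<lambda>x. F x y) X)) Y)"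
  by (induction Y) (simp_all add: label_pairs_Cons o_def)

text \<open>
  Factors that share a label keep their relative order when the loops are exchanged.
\<close>

lemma op_prod_swap_loops:
  assumes "distinct X" "distinct Y"
    and "\<And>x x' y y'. x \<in> set X \<Longrightarrow> x' \<in> set X \<Longrightarrow> y \<in> set Y \<Longrightarrow> y' \<in> set Y \<Longrightarrow>
      x \<noteq> x' \<Longrightarrow> y \<noteq> y' \<Longrightarrow> commute (F x y) (F x' y')"
  shows "op_prod (map (\<lambda>(x, y). F x y) (label_pairs X Y))
    = op_prod (map (\<lambda>(y, x). F x y) (label_pairs Y X))"
  unfolding op_prod_label_pairs op_prod_label_pairs[of "\<lambda>y x. F x y"]
  using assms(1,3)
proof (induction X)
  case Nil
  show ?case by (induction Y) simp_all
next
  case (Cons x X)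
  have "op_prod (map (\<lambda>y. op_prod (map (\<lambda>x. F x y) (x # X))) Y)
      = op_prod (map (\<lambda>y. F x y \<circ> op_prod (map (\<lambda>x. F x y) X)) Y)"
    by simp
  also have "\<dots> = op_prod (map (F x) Y) \<circ> op_prod (map (\<lambda>y. op_prod (map (\<lambda>x. F x y) X)) Y)"
    using Cons.prems
    by (intro op_prod_interleave assms(2) commute_sym[OF commute_op_prod]) auto
  also have "op_prod (map (\<lambda>y. op_prod (map (\<lambda>x. F x y) X)) Y)
      = op_prod (map (\<lambda>x. op_prod (map (\<lambda>y. F x y) Y)) X)"
    using Cons.prems by (intro Cons.IH) auto
  finally show ?case by simp
qed

context quantum_space
begin

text \<open>
  A fused matrix with an arbitrary matrix \<open>G x y\<close> for each pair of labels; conjugates and flips of a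
  fused \<open>R\<close>-matrix have this form, but need not come from a function of one spectral parameter.
\<close>

definition lattice_prod ::
  "(nat \<Rightarrow> nat \<Rightarrow> complex^('d \<times> 'd)^('d \<times> 'd)) \<Rightarrow> nat list \<Rightarrow> nat list \<Rightarrow> ('d::finite, 'w) lab_op" where
  "lattice_prod G X Y = op_prod (map (\<lambda>(x, y). on_sites s (G x y) x y) (label_pairs X Y))"

lemma fused_eq_lattice_prod: "fused s R g X Y = lattice_prod (\<lambda>x y. R (g x y)) X Y"
  by (simp add: fused_eq_op_prod lattice_prod_def)

lemma lattice_prod_cong:
  "(\<And>x y. x \<in> set X \<Longrightarrow> y \<in> set Y \<Longrightarrow> G x y = G' x y) \<Longrightarrow> lattice_prod G X Y = lattice_prod G' X Y"
  unfolding lattice_prod_def by (intro arg_cong[where f=op_prod] map_cong) auto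

lemma linop_op_prod: "(\<And>A. A \<in> set As \<Longrightarrow> linop A) \<Longrightarrow> linop (op_prod As)"
  by (induction As) (simp_all add: linop_id linop_comp)

lemma trivial_at_op_prod: "(\<And>A. A \<in> set As \<Longrightarrow> trivial_at A z) \<Longrightarrow> trivial_at (op_prod As) z"
  by (induction As) (simp_all add: trivial_at_id trivial_at_comp)

lemma linop_lattice_prod: "linop (lattice_prod G X Y)"
  unfolding lattice_prod_def by (intro linop_op_prod) (auto simp: linop_on_sites)

lemma trivial_at_lattice_prod: "z \<notin> set X \<Longrightarrow> z \<notin> set Y \<Longrightarrow> trivial_at (lattice_prod G X Y) z"
  unfolding lattice_prod_def by (intro trivial_at_op_prod) (auto intro!: trivial_at_on_sites)

definition mixed_prod ::
  "(nat \<Rightarrow> nat \<Rightarrow> complex^('d \<times> 'd)^('d \<times> 'd)) \<Rightarrow> (nat \<times> nat) list \<Rightarrow>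
    ('d::finite, 'w) lab_op \<Rightarrow> ('d, 'w) lab_op" where
  "mixed_prod G ps H = foldr (\<lambda>(x, y). mixed (G x y) x y) ps H"

lemma mixed_prod_simps [simp]:
  "mixed_prod G [] H = H"
  "mixed_prod G (p # ps) H = mixed (G (fst p) (snd p)) (fst p) (snd p) (mixed_prod G ps H)"
  by (simp_all add: mixed_prod_def case_prod_unfold)

lemma mixed_prod_append: "mixed_prod G (ps @ qs) H = mixed_prod G ps (mixed_prod G qs H)"
  by (simp add: mixed_prod_def)

lemma linop_mixed_prod: "linop H \<Longrightarrow> linop (mixed_prod G ps H)"
  by (induction ps) (auto intro: linop_mixed)

lemma mixed_prod_comp_right:
  assumes "\<And>p. p \<in> set ps \<Longrightarrow> trivial_at Q (snd p)"
  shows "mixed_prod G ps (H \<circ> Q) = mixed_prod G ps H \<circ> Q"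
  using assms by (induction ps) (simp_all add: mixed_comp_right)

lemma mixed_prod_comp_left:
  assumes "\<And>p. p \<in> set ps \<Longrightarrow> trivial_at Q (fst p)" "linop Q"
  shows "mixed_prod G ps (Q \<circ> H) = Q \<circ> mixed_prod G ps H"
  using assms by (induction ps) (simp_all add: mixed_comp_left)

lemma mixed_prod_commute:
  assumes "\<And>p q. p \<in> set ps \<Longrightarrow> q \<in> set qs \<Longrightarrow> fst p \<noteq> fst q \<and> snd p \<noteq> snd q"
  shows "mixed_prod G ps (mixed_prod G' qs H) = mixed_prod G' qs (mixed_prod G ps H)"
proof -
  have one: "mixed A x y (mixed_prod G' qs H) = mixed_prod G' qs (mixed A x y H)"
    if "\<And>q. q \<in> set qs \<Longrightarrow> x \<noteq> fst q \<and> y \<noteq> snd q" for A x y H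
    using that
  proof (induction qs)
    case (Cons q qs)
    then show ?case by (simp add: mixed_commute[of x "fst q" y "snd q"])
  qed simp
  show ?thesis using assms by (induction ps) (simp_all add: one)
qed

lemma mixed_prod_inverse:
  assumes "\<And>p. p \<in> set ps \<Longrightarrow> transpose2 (A (fst p) (snd p)) ** transpose2 (B (fst p) (snd p)) = mat 1"
    and "linop H"
  shows "mixed_prod A (rev ps) (mixed_prod B ps H) = H"
  using assms
  by (induction ps) (simp_all add: mixed_prod_append mixed_inverse linop_mixed_prod)

text \<open>
  Within one row all factors share the second label \<open>y\<close>. As \<open>mixed\<close> multiplies on \<open>y\<close> from the
  right, the factors are collected in the reversed order, whence \<open>rev X\<close>.
\<close>

lemma mixed_prod_row:
  assumes "distinct X" "y \<notin> set X" "linop H" "trivial_at H y"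
  shows "mixed_prod G (map (\<lambda>x. (x, y)) (rev X)) H
    = op_prod (map (\<lambda>x. on_sites s (G x y) x y) X) \<circ> H"
  using assms(1,2)
proof (induction X rule: rev_induct)
  case (snoc x X)
  let ?row = "op_prod (map (\<lambda>x. on_sites s (G x y) x y) X)"
  have "trivial_at ?row x" "linop ?row"
    using snoc.prems by (auto intro!: trivial_at_op_prod trivial_at_on_sites linop_op_prod linop_on_sites)
  note pull_out = mixed_comp_left[OF this]
  have IH: "mixed_prod G (map (\<lambda>x. (x, y)) (rev X)) H = ?row \<circ> H"
    using snoc.prems by (intro snoc.IH) auto
  have "mixed_prod G (map (\<lambda>x. (x, y)) (rev (X @ [x]))) H = mixed (G x y) x y (?row \<circ> H)"
    by (simp add: IH)
  also have "\<dots> = ?row \<circ> (on_sites s (G x y) x y \<circ> H)"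
    using snoc.prems assms(4) by (simp add: pull_out mixed_trivial_right)
  finally show ?case by (simp add: comp_assoc)
qed simp

text \<open>
  Different rows have different second labels, so the side on which the second factor is multiplied
  does not matter between rows, and only the order inside each row is reversed.
\<close>

lemma lattice_prod_eq_mixed_prod:
  assumes "distinct X" "distinct Y" "set X \<inter> set Y = {}"
  shows "lattice_prod G X Y = mixed_prod G (label_pairs (rev X) Y) id"
  using assms(2,3)
proof (induction Y)
  case Nil
  show ?case by (simp add: lattice_prod_def)
next
  case (Cons y Y)
  have "lattice_prod G X (y # Y) = op_prod (map (\<lambda>x. on_sites s (G x y) x y) X) \<circ> lattice_prod G X Y"
    by (simp add: lattice_prod_def label_pairs_Cons o_def)
  also have "\<dots> = mixed_prod G (map (\<lambda>x. (x, y)) (rev X)) (lattice_prod G X Y)"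
    using Cons.prems assms(1) by (intro mixed_prod_row[symmetric] linop_lattice_prod
        trivial_at_lattice_prod) auto
  finally show ?case
    using Cons by (simp add: label_pairs_Cons mixed_prod_append)
qed

lemma lattice_prod_flip:
  assumes "distinct X" "distinct Y" "set X \<inter> set Y = {}"
  shows "lattice_prod G X Y = lattice_prod (\<lambda>y x. flip (G x y)) Y X"
proof -
  have "lattice_prod G X Y = op_prod (map (\<lambda>(y, x). on_sites s (G x y) x y) (label_pairs Y X))"
    unfolding lattice_prod_def
    by (rule op_prod_swap_loops) (use assms in \<open>auto intro!: commute_on_sites\<close>)
  also have "\<dots> = lattice_prod (\<lambda>y x. flip (G x y)) Y X"
    unfolding lattice_prod_def using assms
    by (intro arg_cong[where f=op_prod] map_cong) (auto intro!: on_sites_flip[symmetric])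
  finally show ?thesis .
qed

section \<open>Operators commuting with a crossed inverse\<close>

text \<open>
  Write \<open>X\<close> for the product of the \<open>B x y\<close> and \<open>Z\<close> for that of the \<open>D x y\<close>. Let \<open>\<mu>\<^sub>X\<close> and \<open>\<mu>\<^sub>Z\<close> be
  the products of the maps \<open>mixed\<close> acting from the left on \<open>P\<close> and from the right on \<open>Y\<close>, and \<open>\<nu>\<^sub>X\<close>,
  \<open>\<nu>\<^sub>Z\<close> the analogous products acting from the left on \<open>Y\<close> and from the right on \<open>P\<close>. All of them
  take the identity to \<open>X\<close> or \<open>Z\<close>. As \<open>A\<close> commutes with everything on \<open>Y\<close>, it can be pulled out:
  \<open>\<mu>\<^sub>X A = X A\<close> and \<open>\<nu>\<^sub>X A = A X\<close>, likewise for \<open>Z\<close>. Hence \<open>A X = X A\<close> says \<open>\<mu>\<^sub>X A = \<nu>\<^sub>X A\<close>.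
  Applying \<open>\<nu>\<^sub>Z \<mu>\<^sub>Z = \<mu>\<^sub>Z \<nu>\<^sub>Z\<close> and cancelling inverses gives \<open>\<nu>\<^sub>Z A = \<mu>\<^sub>Z A\<close>, that is \<open>A Z = Z A\<close>.
  The label lists of \<open>Z\<close> are reversed because \<open>\<mu>\<^sub>Z\<close> has to undo \<open>\<mu>\<^sub>X\<close> factor by factor from the
  outside.
\<close>

lemma commute_crossed_inverse:
  assumes P: "distinct P" and Y: "distinct Y" and disj: "set P \<inter> set Y = {}"
    and inv: "\<And>x y. x \<in> set P \<Longrightarrow> y \<in> set Y \<Longrightarrow> transpose2 (D x y) ** transpose2 (B x y) = mat 1"
    and A: "linop A" "\<And>y. y \<in> set Y \<Longrightarrow> trivial_at A y"
    and com: "commute A (lattice_prod B P Y)"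
  shows "commute A (lattice_prod D (rev P) (rev Y))"
proof -
  let ?ps = "label_pairs (rev P) Y" and ?qs = "label_pairs (rev Y) P"
  let ?B = "\<lambda>y x. flip (B x y)" and ?D = "\<lambda>y x. flip (D x y)"
  have X: "lattice_prod B P Y = mixed_prod B ?ps id"
    using P Y disj by (rule lattice_prod_eq_mixed_prod)
  have X': "lattice_prod B P Y = mixed_prod ?B ?qs id"
    unfolding lattice_prod_flip[OF P Y disj] using disj by (intro lattice_prod_eq_mixed_prod P Y) auto
  have Z: "lattice_prod D (rev P) (rev Y) = mixed_prod D (rev ?ps) id"
    using P Y disj by (subst lattice_prod_eq_mixed_prod) (auto simp: rev_label_pairs)
  have Z': "lattice_prod D (rev P) (rev Y) = mixed_prod ?D (rev ?qs) id"
    using P Y disj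
    by (subst lattice_prod_flip, simp_all) (subst lattice_prod_eq_mixed_prod, auto simp: rev_label_pairs)
  have right: "mixed_prod G ps A = mixed_prod G ps id \<circ> A" if "snd ` set ps \<subseteq> set Y" for G ps
    using mixed_prod_comp_right[of ps A G id] that A(2) by auto
  have left: "mixed_prod G ps A = A \<circ> mixed_prod G ps id" if "fst ` set ps \<subseteq> set Y" for G ps
    using mixed_prod_comp_left[of ps A G id] that A by auto
  have "mixed_prod B ?ps A = lattice_prod B P Y \<circ> A"
    unfolding X by (rule right) auto
  also have "\<dots> = A \<circ> lattice_prod B P Y" using com by (simp add: commute_def)
  also have "\<dots> = mixed_prod ?B ?qs A"
    unfolding X' by (rule left[symmetric]) auto
  finally have eq: "mixed_prod B ?ps A = mixed_prod ?B ?qs A" .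
  have "A \<circ> lattice_prod D (rev P) (rev Y) = mixed_prod ?D (rev ?qs) A"
    unfolding Z' by (rule left[symmetric]) auto
  also have "\<dots> = mixed_prod ?D (rev ?qs) (mixed_prod D (rev ?ps) (mixed_prod B ?ps A))"
    using inv A(1) by (subst mixed_prod_inverse) auto
  also have "\<dots> = mixed_prod D (rev ?ps) (mixed_prod ?D (rev ?qs) (mixed_prod ?B ?qs A))"
    unfolding eq using disj by (subst mixed_prod_commute) auto
  also have "\<dots> = mixed_prod D (rev ?ps) A"
    using inv A(1) by (subst mixed_prod_inverse) (auto intro: transpose2_inverse_flip)
  also have "\<dots> = lattice_prod D (rev P) (rev Y) \<circ> A"
    unfolding Z by (rule right) auto
  finally show ?thesis by (simp add: commute_def)
qed

end

section \<open>Conjugation by M and crossing-unitarity\<close>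

lemma site_prod_simps [simp]:
  "site_prod s C [] = id"
  "site_prod s C (x # X) = on_site s C x \<circ> site_prod s C X"
  "site_prod s C (X @ Y) = site_prod s C X \<circ> site_prod s C Y"
  by (simp_all add: site_prod_def)

lemma tensor_mult: "tensor A B ** tensor C D = tensor (A ** C) (B ** D)"
  by (simp add: tensor_def matrix_matrix_mult_def vec_eq_iff sum_UNIV_pair sum_product mult_ac)

lemma transpose_tensor: "transpose (tensor A B) = tensor (transpose A) (transpose B)"
  by (simp add: transpose_def tensor_def vec_eq_iff)

lemma flip_tensor: "flip (tensor A B) = tensor B A"
  by (simp add: tensor_def vec_eq_iff mult.commute)

lemma tensor_left_nth: "(tensor C (mat 1) ** A) $ i $ j = (\<Sum>k\<in>UNIV. C $ fst i $ k * A $ (k, snd i) $ j)"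
proof -
  have "tensor C (mat 1) $ i $ (k, m) * A $ (k, m) $ j
      = (if m = snd i then C $ fst i $ k * A $ (k, snd i) $ j else 0)" for k m
    by (auto simp: tensor_def mat_def)
  then show ?thesis by (simp add: matrix_matrix_mult_def sum_UNIV_pair)
qed

lemma tensor_right_nth: "(A ** tensor C (mat 1)) $ i $ j = (\<Sum>k\<in>UNIV. A $ i $ (k, snd j) * C $ k $ fst j)"
proof -
  have "A $ i $ (k, m) * tensor C (mat 1) $ (k, m) $ j
      = (if m = snd j then A $ i $ (k, snd j) * C $ k $ fst j else 0)" for k m
    by (auto simp: tensor_def mat_def)
  then show ?thesis by (simp add: matrix_matrix_mult_def sum_UNIV_pair)
qed

lemma transpose2_tensor_left: "transpose2 (tensor C (mat 1) ** A) = tensor C (mat 1) ** transpose2 A"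
  by (simp add: vec_eq_iff transpose2_def tensor_left_nth)

lemma transpose2_tensor_right: "transpose2 (A ** tensor C (mat 1)) = transpose2 A ** tensor C (mat 1)"
  by (simp add: vec_eq_iff transpose2_def tensor_right_nth)

text \<open>
  This is the total transpose of crossing-unitarity. The symmetry of \<open>M\<close> keeps the conjugation in
  place, and since it acts on the first space it is unaffected by transposing the second one. The
  scalar is absorbed into the known factor \<open>B\<close>, so that \<open>A\<close> keeps its normalisation.
\<close>

lemma crossed_inverse_of_crossing_unitarity:
  assumes sym: "transpose M = M" and inv: "M ** M' = mat 1" and k: "k \<noteq> 0"
    and cu: "transpose1 (flip B) ** tensor M' (mat 1) ** transpose1 A ** tensor M (mat 1) = mat k"
  shows "transpose2 (tensor M (mat 1) ** A ** tensor M' (mat 1)) **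
      transpose2 (\<chi> i j. inverse k * flip B $ i $ j) = mat 1"
proof -
  have "transpose M' ** M = mat 1"
    using arg_cong[OF inv, of transpose] by (simp add: matrix_transpose_mul sym transpose_mat)
  then have sym': "transpose M' = M'"
    using inv by (metis matrix_mul_assoc matrix_mul_lid matrix_mul_rid)
  have tt: "transpose (transpose1 C) = transpose2 C" for C :: "complex^('a \<times> 'a)^('a \<times> 'a)"
    by (rule transpose_transpose1)
  have "tensor M (mat 1) ** (transpose2 A ** (tensor M' (mat 1) ** transpose2 (flip B))) = mat k"
    using arg_cong[OF cu, of transpose]
    by (simp add: matrix_transpose_mul tt transpose_tensor sym sym' transpose_mat)
  then have D: "transpose2 (tensor M (mat 1) ** A ** tensor M' (mat 1)) ** transpose2 (flip B) = mat k"
    by (simp add: transpose2_tensor_left transpose2_tensor_right matrix_mul_assoc)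
  have scaled: "C ** transpose2 (\<chi> i j. inverse k * flip B $ i $ j)
      = (\<chi> i j. inverse k * (C ** transpose2 (flip B)) $ i $ j)" for C
    by (simp add: vec_eq_iff matrix_matrix_mult_def transpose2_def sum_distrib_left mult_ac)
  show ?thesis
    unfolding scaled D using k by (simp add: vec_eq_iff mat_def)
qed

text \<open>
  One of the two \<open>R\<close>-matrices of the dual reflection equation is conjugated in its second space, by
  the inverse of \<open>M\<close>. The invariance \<open>[R, M\<^sub>1M\<^sub>2] = 0\<close> moves this conjugation to the first space,
  where crossing-unitarity applies.
\<close>

lemma conjugate_second_eq_first:
  assumes inv: "M ** M' = mat 1" "M' ** M = mat 1" and com: "A ** tensor M M = tensor M M ** A"
  shows "tensor (mat 1) M' ** A ** tensor (mat 1) M = tensor M (mat 1) ** A ** tensor M' (mat 1)"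
proof -
  let ?L = "tensor (mat 1) M'" and ?R = "tensor M' (mat 1)"
  have "?L ** A ** tensor (mat 1) M = ?L ** (A ** tensor M M) ** ?R"
    by (simp add: matrix_mul_assoc[symmetric] tensor_mult inv)
  also have "\<dots> = tensor M (mat 1) ** A ** ?R"
    unfolding com by (simp add: matrix_mul_assoc tensor_mult inv)
  finally show ?thesis .
qed

lemma flip_conjugate:
  "flip (tensor C (mat 1) ** A ** tensor C' (mat 1))
    = tensor (mat 1) C ** flip A ** tensor (mat 1) C'"
  by (simp add: flip_mult flip_tensor)

context quantum_space
begin

lemma site_prod_inverse:
  assumes "C ** C' = mat 1"
  shows "site_prod s C X \<circ> site_prod s C' (rev X) = id"
proof (induction X)
  case (Cons x X)
  have "site_prod s C (x # X) \<circ> site_prod s C' (rev (x # X))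
      = on_site s C x \<circ> (site_prod s C X \<circ> site_prod s C' (rev X)) \<circ> on_site s C' x"
    by (simp add: comp_assoc)
  also have "\<dots> = id"
    unfolding Cons.IH by (simp add: fun_eq_iff on_site_mult assms on_site_one)
  finally show ?case .
qed simp

lemma site_prod_conjugate_trivial:
  assumes "C ** C' = mat 1" "\<And>x. x \<in> set X \<Longrightarrow> trivial_at L x"
  shows "site_prod s C X \<circ> L \<circ> site_prod s C' (rev X) = L"
proof -
  have "commute L (site_prod s C X)"
    unfolding site_prod_def using assms(2) by (intro commute_op_prod) (auto simp: trivial_at_def)
  then have "site_prod s C X \<circ> L \<circ> site_prod s C' (rev X) = L \<circ> (site_prod s C X \<circ> site_prod s C' (rev X))"
    by (simp add: commute_def comp_assoc[symmetric])
  then show ?thesis by (simp add: site_prod_inverse[OF assms(1)])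
qed

lemma site_prod_conjugate_on_sites:
  assumes "C ** C' = mat 1" "distinct X" "x \<in> set X" "y \<notin> set X"
  shows "site_prod s C X \<circ> on_sites s A x y \<circ> site_prod s C' (rev X)
    = on_sites s (tensor C (mat 1) ** A ** tensor C' (mat 1)) x y" (is "_ = on_sites s ?A x y")
  using assms(2-4)
proof (induction X)
  case (Cons z X)
  have xy: "x \<noteq> y" using Cons.prems by auto
  let ?c = "\<lambda>L. site_prod s C X \<circ> L \<circ> site_prod s C' (rev X)"
  have *: "site_prod s C (z # X) \<circ> on_sites s A x y \<circ> site_prod s C' (rev (z # X))
      = on_site s C z \<circ> ?c (on_sites s A x y) \<circ> on_site s C' z"
    by (simp add: comp_assoc)
  show ?case
  proof (cases "z = x")
    case True
    have c: "?c (on_sites s A x y) = on_sites s A x y"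
      using Cons.prems True by (intro site_prod_conjugate_trivial assms(1) trivial_at_on_sites) auto
    show ?thesis
      unfolding * c using xy
      by (simp add: True on_site_eq_on_sites[OF xy] fun_eq_iff on_sites_mult matrix_mul_assoc)
  next
    case False
    have c: "?c (on_sites s A x y) = on_sites s ?A x y"
      using Cons.prems False by (intro Cons.IH) auto
    show ?thesis
      using site_prod_conjugate_trivial[OF assms(1), of "[z]" "on_sites s ?A x y"] False Cons.prems
      unfolding * c by (simp add: trivial_at_on_sites)
  qed
qed simp

lemma site_prod_conjugate_lattice_prod:
  assumes CC': "C ** C' = mat 1" "C' ** C = mat 1" and X: "distinct X" "set P \<subseteq> set X" "set Y \<inter> set X = {}"
  shows "site_prod s C X \<circ> lattice_prod G P Y \<circ> site_prod s C' (rev X)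
    = lattice_prod (\<lambda>x y. tensor C (mat 1) ** G x y ** tensor C' (mat 1)) P Y"
proof -
  let ?c = "\<lambda>L. site_prod s C X \<circ> L \<circ> site_prod s C' (rev X)"
  have inv: "site_prod s C' (rev X) \<circ> site_prod s C X = id"
    using site_prod_inverse[OF CC'(2), of "rev X"] by simp
  have c: "?c (K \<circ> L) = ?c K \<circ> ?c L" for K L
  proof -
    have "?c K \<circ> ?c L = site_prod s C X \<circ> K \<circ> (site_prod s C' (rev X) \<circ> site_prod s C X)
        \<circ> L \<circ> site_prod s C' (rev X)"
      by (simp add: comp_assoc)
    then show ?thesis unfolding inv by (simp add: comp_assoc)
  qed
  have "?c (op_prod (map (\<lambda>(x, y). on_sites s (G x y) x y) ps))
      = op_prod (map (\<lambda>(x, y). on_sites s (tensor C (mat 1) ** G x y ** tensor C' (mat 1)) x y) ps)"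
    if "set ps \<subseteq> set P \<times> set Y" for ps
    using that
  proof (induction ps)
    case Nil
    show ?case by (simp add: site_prod_inverse[OF CC'(1)])
  next
    case (Cons p ps)
    have p: "?c (on_sites s (G (fst p) (snd p)) (fst p) (snd p))
        = on_sites s (tensor C (mat 1) ** G (fst p) (snd p) ** tensor C' (mat 1)) (fst p) (snd p)"
      using Cons.prems X by (intro site_prod_conjugate_on_sites CC' X) auto
    have ps: "?c (op_prod (map (\<lambda>(x, y). on_sites s (G x y) x y) ps))
      = op_prod (map (\<lambda>(x, y). on_sites s (tensor C (mat 1) ** G x y ** tensor C' (mat 1)) x y) ps)"
      using Cons.prems by (intro Cons.IH) auto
    show ?case
      unfolding list.map op_prod_simps c case_prod_unfold
        p[unfolded case_prod_unfold] ps[unfolded case_prod_unfold]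
      by (rule refl)
  qed
  then show ?thesis unfolding lattice_prod_def by auto
qed

lemma lattice_prod_scale:
  assumes "set X \<inter> set Y = {}"
  shows "\<exists>\<kappa>. \<forall>f. lattice_prod (\<lambda>x y. \<chi> i j. k x y * G x y $ i $ j) X Y f
    = (\<lambda>c. s \<kappa> (lattice_prod G X Y f c))"
proof -
  have "\<exists>\<kappa>. \<forall>f. op_prod (map (\<lambda>(x, y). on_sites s (\<chi> i j. k x y * G x y $ i $ j) x y) ps) f
      = (\<lambda>c. s \<kappa> (op_prod (map (\<lambda>(x, y). on_sites s (G x y) x y) ps) f c))"
    if "set ps \<subseteq> set X \<times> set Y" for ps
    using that
  proof (induction ps)
    case Nil
    show ?case by (intro exI[of _ 1]) simp
  next
    case (Cons p ps)
    then obtain \<kappa> where \<kappa>: "\<forall>f. op_prod (map (\<lambda>(x, y). on_sites s (\<chi> i j. k x y * G x y $ i $ j) x y) ps) f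
      = (\<lambda>c. s \<kappa> (op_prod (map (\<lambda>(x, y). on_sites s (G x y) x y) ps) f c))" by auto
    have "fst p \<noteq> snd p" using Cons.prems assms by auto
    then show ?case
      by (intro exI[of _ "k (fst p) (snd p) * \<kappa>"])
        (simp add: \<kappa>[unfolded case_prod_unfold] case_prod_unfold on_sites_scale
          linop_scale[OF linop_on_sites] mult.commute)
  qed
  from this[of "label_pairs X Y"] show ?thesis unfolding lattice_prod_def by auto
qed

text \<open>
  The argument is symmetric in the two label sets, so \<open>A\<close> may live on either of them. Scalar factors
  in the crossed inverse relation are harmless because \<open>A\<close> is linear.
\<close>

lemma commute_crossed_inverse_of_fused:
  assumes P: "distinct P" and Y: "distinct Y" and disj: "set P \<inter> set Y = {}"
    and inv: "\<And>x y. x \<in> set P \<Longrightarrow> y \<in> set Y \<Longrightarrow> \<exists>k.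
      transpose2 (D x y) ** transpose2 (\<chi> i j. k * flip (R (g y x)) $ i $ j) = mat 1"
    and A: "linop A" "(\<forall>z\<in>set Y. trivial_at A z) \<or> (\<forall>z\<in>set P. trivial_at A z)"
    and com: "commute A (fused s R g Y P)"
  shows "commute A (lattice_prod D (rev P) (rev Y))"
proof -
  obtain k where k: "\<And>x y. x \<in> set P \<Longrightarrow> y \<in> set Y \<Longrightarrow>
      transpose2 (D x y) ** transpose2 (\<chi> i j. k x y * flip (R (g y x)) $ i $ j) = mat 1"
    using inv by metis
  let ?B = "\<lambda>x y. \<chi> i j. k x y * flip (R (g y x)) $ i $ j"
  have disj': "set Y \<inter> set P = {}" using disj by blast
  let ?G = "\<lambda>x y. flip (R (g y x))"
  have "fused s R g Y P = lattice_prod ?G P Y"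
    unfolding fused_eq_lattice_prod by (rule lattice_prod_flip[OF Y P disj'])
  then have comG: "A (lattice_prod ?G P Y f) = lattice_prod ?G P Y (A f)" for f
    using commuteD[OF com] by simp
  obtain \<kappa> where \<kappa>: "\<forall>f. lattice_prod ?B P Y f = (\<lambda>c. s \<kappa> (lattice_prod ?G P Y f c))"
    using lattice_prod_scale[OF disj, of k ?G] by blast
  have com: "commute A (lattice_prod ?B P Y)"
    unfolding commute_def by (rule ext) (simp only: comp_apply spec[OF \<kappa>] linop_scale[OF A(1)] comG)
  from A(2) show ?thesis
  proof
    assume "\<forall>z\<in>set Y. trivial_at A z"
    then show ?thesis
      using k by (intro commute_crossed_inverse[OF P Y disj _ A(1) _ com]) auto
  next
    assume "\<forall>z\<in>set P. trivial_at A z"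
    then have "commute A (lattice_prod (\<lambda>y x. flip (D x y)) (rev Y) (rev P))"
      using com k unfolding lattice_prod_flip[OF P Y disj]
      by (intro commute_crossed_inverse[OF Y P disj' _ A(1)]) (auto intro: transpose2_inverse_flip)
    then show ?thesis
      using P Y disj by (subst lattice_prod_flip) auto
  qed
qed

section \<open>From the trivial to an arbitrary quantum space\<close>

text \<open>
  The hypotheses on \<open>Q\<close> and \<open>S\<close> concern the trivial quantum space. A c-number operator commutes with
  applying a linear functional of the quantum space to all components, and functionals separate
  points, so commutation relations between such operators carry over to every quantum space.
\<close>

abbreviation functional :: "('w \<Rightarrow> complex) \<Rightarrow> bool" where
  "functional \<equiv> Vector_Spaces.linear s (*)"

lemma functionals_separate:
  assumes "\<And>\<phi>. functional \<phi> \<Longrightarrow> \<phi> v = \<phi> w"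
  shows "v = w"
proof (rule ccontr)
  assume "v \<noteq> w"
  interpret vp: vector_space_pair s "(*) :: complex \<Rightarrow> complex \<Rightarrow> complex"
    by unfold_locales (auto simp: algebra_simps)
  have "\<exists>\<phi>. functional \<phi> \<and> (\<forall>x\<in>{v - w}. \<phi> x = 1)"
    using \<open>v \<noteq> w\<close> by (intro vp.linear_independent_extend) simp
  then obtain \<phi> where \<phi>: "functional \<phi>" "\<phi> (v - w) = 1" by auto
  then have "\<phi> v - \<phi> w = 1" by (simp add: vp.linear_diff)
  with assms[OF \<phi>(1)] show False by simp
qed

definition represents :: "('d, complex) lab_op \<Rightarrow> ('d, 'w) lab_op \<Rightarrow> bool" where
  "represents A' A \<longleftrightarrow> (\<forall>\<phi> f. functional \<phi> \<longrightarrow> (\<lambda>c. \<phi> (A f c)) = A' (\<lambda>c. \<phi> (f c)))"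

lemma representsD: "represents A' A \<Longrightarrow> functional \<phi> \<Longrightarrow> A' (\<lambda>c. \<phi> (f c)) = (\<lambda>c. \<phi> (A f c))"
  by (simp add: represents_def)

lemma represents_comp:
  assumes "represents A' A" "represents B' B"
  shows "represents (A' \<circ> B') (A \<circ> B)"
  unfolding represents_def
proof (intro allI impI)
  fix \<phi> f assume \<phi>: "functional \<phi>"
  show "(\<lambda>c. \<phi> ((A \<circ> B) f c)) = (A' \<circ> B') (\<lambda>c. \<phi> (f c))"
    by (simp add: representsD[OF assms(1) \<phi>] representsD[OF assms(2) \<phi>])
qed

lemma represents_place:
  fixes A :: "'d::finite list \<Rightarrow> 'd list \<Rightarrow> complex"
  shows "represents (place X (cnumber (*) A)) (place X (cnumber s A))"
proof -
  have "(\<lambda>c. \<phi> (place X (cnumber s A) f c)) = place X (cnumber (*) A) (\<lambda>c. \<phi> (f c))"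
    if "functional \<phi>" for \<phi> f
  proof -
    from that have "module_hom s (*) \<phi>" by (simp add: Vector_Spaces.linear_def)
    then show ?thesis
      by (simp add: place_agree[abs_def] cnumber_def module_hom.sum module_hom.scale)
  qed
  then show ?thesis by (simp add: represents_def)
qed

lemma represents_op_prod:
  assumes "\<And>p. p \<in> set ps \<Longrightarrow> represents (F' p) (F p)"
  shows "represents (op_prod (map F' ps)) (op_prod (map F ps))"
  using assms
proof (induction ps)
  case Nil
  show ?case by (simp add: represents_def)
next
  case (Cons p ps)
  then show ?case unfolding list.map op_prod_simps by (intro represents_comp) auto
qed

lemma represents_fused: "represents (fused (*) R g X Y) (fused s R g X Y)"
  unfolding fused_eq_op_prod on_sites_def
  by (intro represents_op_prod) (auto simp: represents_place)

lemma represents_commute: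
  assumes "represents A' A" "represents B' B" "commute A' B'"
  shows "commute A B"
  unfolding commute_def
proof (intro ext functionals_separate)
  fix f c \<phi> assume \<phi>: "functional \<phi>"
  have "(\<lambda>c. \<phi> ((A \<circ> B) f c)) = (\<lambda>c. \<phi> ((B \<circ> A) f c))"
    using commuteD[OF assms(3)] representsD[OF represents_comp[OF assms(1,2)] \<phi>]
      representsD[OF represents_comp[OF assms(2,1)] \<phi>] by simp
  then show "\<phi> ((A \<circ> B) f c) = \<phi> ((B \<circ> A) f c)" by (rule fun_cong)
qed

lemma commute_transfer:
  assumes "commute (fam_at (cnumber_family (*) Q) N l) (fused (*) R g X Y)"
  shows "commute (fam_at (cnumber_family s Q) N l) (fused s R g X Y)"
  by (rule represents_commute[OF _ represents_fused assms])
    (simp add: fam_at_def cnumber_family_def represents_place)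

end

section \<open>Generic parameters\<close>

lemma generically_mono: "generically P \<Longrightarrow> (\<And>x. P x \<Longrightarrow> Q x) \<Longrightarrow> generically Q"
  unfolding generically_def by blast

lemma dense_iff: "closure S = UNIV \<longleftrightarrow> (\<forall>W. open W \<longrightarrow> W \<noteq> {} \<longrightarrow> W \<inter> S \<noteq> {})"
proof
  assume "closure S = UNIV"
  then show "\<forall>W. open W \<longrightarrow> W \<noteq> {} \<longrightarrow> W \<inter> S \<noteq> {}"
    by (metis Int_UNIV_right open_Int_closure_eq_empty)
next
  assume "\<forall>W. open W \<longrightarrow> W \<noteq> {} \<longrightarrow> W \<inter> S \<noteq> {}"
  then have "- closure S = {}"
    by (metis Compl_disjoint2 closed_closure open_Compl open_Int_closure_eq_empty)
  then show "closure S = UNIV" by auto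
qed

lemma generically_conj:
  assumes "generically P" "generically Q"
  shows "generically (\<lambda>x. P x \<and> Q x)"
proof -
  obtain U V where U: "open U" "closure U = UNIV" "\<forall>u\<in>U. P u" and V: "open V" "closure V = UNIV" "\<forall>u\<in>V. Q u"
    using assms unfolding generically_def by auto
  have "closure (U \<inter> V) = UNIV"
    using U(1,2) V(1,2) unfolding dense_iff by (metis Int_assoc open_Int)
  with U V show ?thesis unfolding generically_def by (intro exI[of _ "U \<inter> V"]) auto
qed

lemma generically_ball:
  assumes "finite I" "\<And>i. i \<in> I \<Longrightarrow> generically (P i)"
  shows "generically (\<lambda>x. \<forall>i\<in>I. P i x)"
  using assms
proof induction
  case empty
  show ?case unfolding generically_def by (intro exI[of _ UNIV]) auto
next
  case (insert i I)
  then show ?case by (simp add: generically_conj)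
qed

text \<open>
  Continuous sections through every point make \<open>h\<close> open in the sense needed here: a nonempty open
  set contains points mapped into any prescribed dense set.
\<close>

lemma generically_comp:
  fixes h :: "'a::topological_space \<Rightarrow> 'b::topological_space"
  assumes "generically P" and h: "continuous_on UNIV h"
    and sect: "\<And>x. \<exists>\<sigma>. continuous_on UNIV \<sigma> \<and> \<sigma> (h x) = x \<and> (\<forall>u. h (\<sigma> u) = u)"
  shows "generically (\<lambda>x. P (h x))"
proof -
  obtain U where U: "open U" "closure U = UNIV" "\<forall>u\<in>U. P u"
    using assms(1) unfolding generically_def by auto
  have "closure (h -` U) = UNIV"
    unfolding dense_iff
  proof (intro allI impI)
    fix W :: "'a set" assume W: "open W" "W \<noteq> {}"
    then obtain x where "x \<in> W" by auto
    obtain \<sigma> where \<sigma>: "continuous_on UNIV \<sigma>" "\<sigma> (h x) = x" "\<And>u. h (\<sigma> u) = u"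
      using sect by blast
    have "open (\<sigma> -` W)" "\<sigma> -` W \<noteq> {}"
      using open_vimage[OF W(1) \<sigma>(1)] \<open>x \<in> W\<close> \<sigma>(2) by auto
    then have "\<sigma> -` W \<inter> U \<noteq> {}" using U(2) unfolding dense_iff by blast
    then obtain u where "\<sigma> u \<in> W" "h (\<sigma> u) \<in> U" by (auto simp: \<sigma>(3))
    then show "W \<inter> h -` U \<noteq> {}" by auto
  qed
  with U open_vimage[OF U(1) h] show ?thesis
    unfolding generically_def by (intro exI[of _ "h -` U"]) auto
qed

lemma generically_label_sum:
  fixes a b :: complex and x y :: nat
  assumes "generically P" "x \<noteq> y" "a \<noteq> 0"
  shows "generically (\<lambda>l. P (a * (l x + l y) + b))"
proof (rule generically_comp[OF assms(1)])
  show "continuous_on UNIV (\<lambda>l :: nat \<Rightarrow> complex. a * (l x + l y) + b)"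
    by (intro continuous_intros continuous_on_product_coordinates)
next
  fix l :: "nat \<Rightarrow> complex"
  \<comment> \<open>The prescribed value \<open>u\<close> is reached by changing \<open>l x\<close> alone, which leaves \<open>l y\<close> fixed because \<open>x \<noteq> y\<close>.\<close>
  have "continuous_on UNIV (\<lambda>u. l(x := (u - b) / a - l y))"
  proof (rule continuous_on_coordinatewise_then_product)
    show "continuous_on UNIV (\<lambda>u. (l(x := (u - b) / a - l y)) i)" for i
      using assms(3) by (cases "i = x") (auto intro!: continuous_intros)
  qed
  then show "\<exists>\<sigma>. continuous_on UNIV \<sigma> \<and> \<sigma> (a * (l x + l y) + b) = l \<and> (\<forall>u. a * (\<sigma> u x + \<sigma> u y) + b = u)"
    using assms(2,3) by (intro exI[of _ "\<lambda>u. l(x := (u - b) / a - l y)"]) auto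
qed

text \<open>
  Crossing-unitarity at \<open>u\<close>, bundled with the invariance under \<open>M\<^sub>1M\<^sub>2\<close> at the crossed value
  \<open>-u - 2\<rho>\<close>, at which the conjugated \<open>R\<close>-matrices are evaluated.
\<close>

definition crossing_unitary_at ::
  "(complex \<Rightarrow> complex^('d::finite \<times> 'd)^('d \<times> 'd)) \<Rightarrow> complex^'d^'d \<Rightarrow> complex \<Rightarrow> complex \<Rightarrow> bool" where
  "crossing_unitary_at R M \<rho> u \<longleftrightarrow>
    (\<exists>k. k \<noteq> 0 \<and> transpose1 (flip (R u)) ** tensor (matrix_inv M) (mat 1)
       ** transpose1 (R (- u - 2 * \<rho>)) ** tensor M (mat 1) = mat k) \<and>
    R (- u - 2 * \<rho>) ** tensor M M = tensor M M ** R (- u - 2 * \<rho>)"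

lemma generically_crossing_unitary:
  assumes "crossing_unitarity R M \<rho>" "commutes_with_MM R M" "disjoint_ordered_sets X Y"
  shows "generically (\<lambda>l. \<forall>x\<in>set X. \<forall>y\<in>set Y. crossing_unitary_at R M \<rho> (l x + l y))"
proof (intro generically_ball finite_set)
  fix x y assume "x \<in> set X" "y \<in> set Y"
  then have "x \<noteq> y" using assms(3) by (auto simp: disjoint_ordered_sets_def)
  from generically_conj[OF
      generically_label_sum[OF assms(1)[unfolded crossing_unitarity_def] this, of 1 0]
      generically_label_sum[OF assms(2)[unfolded commutes_with_MM_def] this, of "-1" "- 2 * \<rho>"]]
  show "generically (\<lambda>l. crossing_unitary_at R M \<rho> (l x + l y))"
    by (simp add: crossing_unitary_at_def)
qed

section \<open>The dressed families\<close>

text \<open>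
  The shape shared by the reflection equation and, with \<open>R1\<close> and \<open>R4\<close> the conjugated \<open>R\<close>-matrices,
  by its dual. On both sides of the equation the dressing operators can be moved to the right end.
\<close>

lemma dress_right:
  assumes "commute QN R1" "commute QN TM" "commute QN QM" "commute QN R2"
    and "commute QM R2" "commute QM R4" "commute QM TN"
    and eq: "TN \<circ> R1 \<circ> TM \<circ> R2 = R3 \<circ> TM \<circ> R4 \<circ> TN"
  shows "(TN \<circ> QN) \<circ> R1 \<circ> (TM \<circ> QM) \<circ> R2 = R3 \<circ> (TM \<circ> QM) \<circ> R4 \<circ> (TN \<circ> QN)"
proof
  fix f
  have "TN (R1 (TM (R2 g))) = R3 (TM (R4 (TN g)))" for g
    using fun_cong[OF eq, of g] by simp
  then show "((TN \<circ> QN) \<circ> R1 \<circ> (TM \<circ> QM) \<circ> R2) f = (R3 \<circ> (TM \<circ> QM) \<circ> R4 \<circ> (TN \<circ> QN)) f"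
    by (simp add: assms(1-7)[THEN commuteD])
qed

text \<open>
  The mirror image: here the dressing operators move to the left end.
\<close>

lemma dress_left:
  assumes "commute SM R1" "commute SM TN" "commute SN SM" "commute SM R3"
    and "commute SN R4" "commute SN TM" "commute SN R3"
    and eq: "TN \<circ> R1 \<circ> TM \<circ> R2 = R3 \<circ> TM \<circ> R4 \<circ> TN"
  shows "(SN \<circ> TN) \<circ> R1 \<circ> (SM \<circ> TM) \<circ> R2 = R3 \<circ> (SM \<circ> TM) \<circ> R4 \<circ> (SN \<circ> TN)"
proof
  fix f
  have "TN (R1 (TM (R2 g))) = R3 (TM (R4 (TN g)))" for g
    using fun_cong[OF eq, of g] by simp
  then show "((SN \<circ> TN) \<circ> R1 \<circ> (SM \<circ> TM) \<circ> R2) f = (R3 \<circ> (SM \<circ> TM) \<circ> R4 \<circ> (SN \<circ> TN)) f"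
    by (simp add: assms(1,2,4-7)[THEN commuteD, symmetric] assms(3)[THEN commuteD])
qed

context quantum_space
begin

lemma linear_entries_linmat: "linear_entries s A \<Longrightarrow> X \<noteq> [] \<Longrightarrow> linmat (length X) (A (map l X))"
  by (simp add: linear_entries_def linmat_def)

lemma linear_entries_cnumber_family: "linear_entries s (cnumber_family s Q)"
  by (simp add: linear_entries_def cnumber_family_def cnumber_def linmap_scale_const)

lemma linear_entries_family_mult:
  assumes "linear_entries s A" "linear_entries s B"
  shows "linear_entries s (family_mult A B)"
  using assms unfolding linear_entries_def family_mult_def linmap_iff
  by (simp add: sum.distrib scale_sum_right)

lemma fam_at_family_mult:
  assumes "linear_entries s A" "X \<noteq> []" "distinct X"
  shows "fam_at (family_mult A B) X l = fam_at A X l \<circ> fam_at B X l"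
  unfolding fam_at_def place_comp_place[OF assms(3) linear_entries_linmat[OF assms(1,2)]]
  by (simp add: family_mult_def[abs_def])

lemma commute_fam_at:
  assumes "linear_entries s A" "disjoint_ordered_sets X Y \<or> disjoint_ordered_sets Y X"
  shows "commute (fam_at (cnumber_family s Q) X l) (fam_at A Y l)"
  unfolding fam_at_def cnumber_family_def
  by (intro commute_place_cnumber linear_entries_linmat)
    (use assms in \<open>auto simp: disjoint_ordered_sets_def\<close>)

text \<open>
  The step in which the dual case differs from the direct one. With \<open>X = M'\<close> and \<open>Y = N\<close> the first
  conclusion concerns the left side of the dual equation, with \<open>X = N\<close> and \<open>Y = M'\<close> the second one
  concerns the right side. Either conjugated matrix is, up to a scalar, the crossed inverse of
  \<open>R\<^bsub>Y X\<^esub>(\<lambda>\<^sub>Y + \<lambda>\<^sub>X)\<close>.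
\<close>

lemma commute_conjugated_fused:
  assumes disj: "disjoint_ordered_sets X Y" and Z: "Z = X \<or> Z = Y"
    and M: "transpose M = M" "M ** matrix_inv M = mat 1" "matrix_inv M ** M = mat 1"
    and R: "\<forall>x\<in>set X. \<forall>y\<in>set Y. crossing_unitary_at R M \<rho> (l x + l y)"
    and com: "commute (fam_at (cnumber_family s Q) Z l) (fused s R (\<lambda>y x. l y + l x) Y X)"
  shows "commute (fam_at (cnumber_family s Q) Z l)
      (site_prod s M X \<circ> fused s R (\<lambda>x y. - l x - l y - 2 * \<rho>) (rev X) (rev Y)
        \<circ> site_prod s (matrix_inv M) (rev X))"
    and "commute (fam_at (cnumber_family s Q) Z l)
      (site_prod s (matrix_inv M) (rev Y) \<circ> fused s R (\<lambda>x y. - l x - l y - 2 * \<rho>) (rev X) (rev Y)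
        \<circ> site_prod s M Y)"
proof -
  let ?A = "fam_at (cnumber_family s Q) Z l" and ?R = "\<lambda>x y. R (- l x - l y - 2 * \<rho>)"
  let ?D = "\<lambda>x y. tensor M (mat 1) ** ?R x y ** tensor (matrix_inv M) (mat 1)"
  have X: "distinct X" and Y: "distinct Y" and XY: "set X \<inter> set Y = {}"
    using disj by (auto simp: disjoint_ordered_sets_def)
  have A: "linop ?A" "(\<forall>z\<in>set Y. trivial_at ?A z) \<or> (\<forall>z\<in>set X. trivial_at ?A z)"
    using Z XY unfolding fam_at_def cnumber_family_def
    by (auto intro!: linop_place trivial_at_place simp: linmat_cnumber)
  have main: "commute ?A (lattice_prod ?D (rev X) (rev Y))"
  proof (rule commute_crossed_inverse_of_fused[OF X Y XY _ A com])
    fix x y assume "x \<in> set X" "y \<in> set Y"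
    then have "crossing_unitary_at R M \<rho> (l x + l y)" using R by blast
    then obtain k where "k \<noteq> 0" "transpose1 (flip (R (l x + l y))) ** tensor (matrix_inv M) (mat 1)
        ** transpose1 (?R x y) ** tensor M (mat 1) = mat k"
      by (auto simp: crossing_unitary_at_def diff_diff_eq)
    then show "\<exists>k. transpose2 (?D x y) ** transpose2 (\<chi> i j. k * flip (R (l y + l x)) $ i $ j) = mat 1"
      using crossed_inverse_of_crossing_unitarity[OF M(1,2)] by (metis add.commute)
  qed
  have "site_prod s M X \<circ> lattice_prod ?R (rev X) (rev Y) \<circ> site_prod s (matrix_inv M) (rev X)
      = lattice_prod ?D (rev X) (rev Y)"
    using X XY by (intro site_prod_conjugate_lattice_prod M) auto
  then show "commute ?A (site_prod s M X \<circ> fused s R (\<lambda>x y. - l x - l y - 2 * \<rho>) (rev X) (rev Y)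
        \<circ> site_prod s (matrix_inv M) (rev X))"
    using main by (simp add: fused_eq_lattice_prod)
  \<comment> \<open>Conjugation on \<open>Y\<close>, the second space, becomes conjugation in the first space after a flip.\<close>
  have "site_prod s (matrix_inv M) (rev Y) \<circ> lattice_prod (\<lambda>y x. flip (?R x y)) (rev Y) (rev X)
        \<circ> site_prod s M (rev (rev Y))
      = lattice_prod (\<lambda>y x. tensor (matrix_inv M) (mat 1) ** flip (?R x y) ** tensor M (mat 1)) (rev Y) (rev X)"
    using Y XY by (intro site_prod_conjugate_lattice_prod M) auto
  also have "\<dots> = lattice_prod (\<lambda>x y. flip (tensor (matrix_inv M) (mat 1) ** flip (?R x y)
      ** tensor M (mat 1))) (rev X) (rev Y)"
    using X Y XY by (intro lattice_prod_flip) auto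
  also have "\<dots> = lattice_prod ?D (rev X) (rev Y)"
    using R by (intro lattice_prod_cong) (simp add: crossing_unitary_at_def diff_diff_eq flip_conjugate
        flip_flip conjugate_second_eq_first M)
  also have "lattice_prod (\<lambda>y x. flip (?R x y)) (rev Y) (rev X) = lattice_prod ?R (rev X) (rev Y)"
    using X Y XY by (intro lattice_prod_flip[symmetric]) auto
  finally have eq: "site_prod s (matrix_inv M) (rev Y) \<circ> lattice_prod ?R (rev X) (rev Y)
        \<circ> site_prod s M (rev (rev Y))
      = lattice_prod ?D (rev X) (rev Y)" .
  show "commute ?A (site_prod s (matrix_inv M) (rev Y) \<circ> fused s R (\<lambda>x y. - l x - l y - 2 * \<rho>) (rev X) (rev Y)
        \<circ> site_prod s M Y)"
    using main unfolding fused_eq_lattice_prod eq[unfolded rev_rev_ident] .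
qed

end

context quantum_space
begin

text \<open>
  The three commutation relations that the proofs use, for a pair \<open>N\<close>, \<open>M'\<close>. The last one is an
  instance for the reversed list \<open>rev M'\<close>, which is again an ordered set of labels.
\<close>

lemma Q_commutation_generically:
  assumes Q: "Q_commutation R Q" and disj: "disjoint_ordered_sets N M'"
  shows "generically (\<lambda>l.
    commute (fam_at (cnumber_family s Q) N l) (fused s R (\<lambda>x y. l x + l y) M' N) \<and>
    commute (fam_at (cnumber_family s Q) N l) (fused s R (\<lambda>x y. l y - l x) (rev N) M') \<and>
    commute (fam_at (cnumber_family s Q) N l) (fused s R (\<lambda>x y. l y - l x) (rev M') N))"
proof -
  have disj': "disjoint_ordered_sets N (rev M')"
    using disj by (simp add: disjoint_ordered_sets_def)
  have "generically (\<lambda>l. commute (fam_at (cnumber_family (*) Q) N l) (fused (*) R (\<lambda>x y. l y + l x) M' N))"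
    "generically (\<lambda>l. commute (fam_at (cnumber_family (*) Q) N l) (fused (*) R (\<lambda>x y. l y - l x) (rev N) M'))"
    "generically (\<lambda>l. commute (fam_at (cnumber_family (*) Q) N l) (fused (*) R (\<lambda>x y. l y - l x) (rev M') N))"
    using Q[unfolded Q_commutation_def, rule_format, OF disj, of 1]
      Q[unfolded Q_commutation_def, rule_format, OF disj', of "-1"] by auto
  from generically_conj[OF this(1) generically_conj[OF this(2,3)]] show ?thesis
    by (rule generically_mono) (simp add: commute_transfer add.commute)
qed

lemma S_commutation_generically:
  assumes S: "S_commutation R S" and disj: "disjoint_ordered_sets N M'"
  shows "generically (\<lambda>l.
    commute (fam_at (cnumber_family s S) N l) (fused s R (\<lambda>x y. l x + l y) N M') \<and>
    commute (fam_at (cnumber_family s S) N l) (fused s R (\<lambda>x y. l x - l y) M' (rev N)) \<and>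
    commute (fam_at (cnumber_family s S) N l) (fused s R (\<lambda>x y. l x - l y) N (rev M')))"
proof -
  have disj': "disjoint_ordered_sets N (rev M')"
    using disj by (simp add: disjoint_ordered_sets_def)
  have "generically (\<lambda>l. commute (fam_at (cnumber_family (*) S) N l) (fused (*) R (\<lambda>x y. l x + l y) N M'))"
    "generically (\<lambda>l. commute (fam_at (cnumber_family (*) S) N l) (fused (*) R (\<lambda>x y. l x - l y) M' (rev N)))"
    "generically (\<lambda>l. commute (fam_at (cnumber_family (*) S) N l) (fused (*) R (\<lambda>x y. l x - l y) N (rev M')))"
    using S[unfolded S_commutation_def, rule_format, OF disj, of 1]
      S[unfolded S_commutation_def, rule_format, OF disj', of "-1"] by auto
  from generically_conj[OF this(1) generically_conj[OF this(2,3)]] show ?thesis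
    by (rule generically_mono) (simp add: commute_transfer)
qed

lemma argument_orders:
  fixes l :: "nat \<Rightarrow> complex"
  shows "(\<lambda>x y. l y + l x) = (\<lambda>x y. l x + l y)"
    and "(\<lambda>x y. - l x + l y) = (\<lambda>x y. l y - l x)"
    and "(\<lambda>x y. - l y + l x) = (\<lambda>x y. l x - l y)"
    and "(\<lambda>x y. - l y - l x - r) = (\<lambda>x y. - l x - l y - r)"
  by (auto simp: fun_eq_iff algebra_simps)

lemma reflection_solutions_mult_right:
  fixes R :: "complex \<Rightarrow> complex^('d::finite \<times> 'd)^('d \<times> 'd)"
  assumes Q: "Q_commutation R Q" and T: "reflection_solutions s R T"
  shows "reflection_solutions s R (family_mult T (cnumber_family s Q))"
  unfolding reflection_solutions_def argument_orders
proof (intro conjI allI impI)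
  have lin: "linear_entries s T" using T by (simp add: reflection_solutions_def)
  let ?Q = "cnumber_family s Q"
  show "linear_entries s (family_mult T ?Q)"
    by (intro linear_entries_family_mult lin linear_entries_cnumber_family)
  fix N M' :: "nat list" assume disj: "disjoint_ordered_sets N M'"
  then have disj': "disjoint_ordered_sets M' N" and N: "N \<noteq> []" "distinct N" and M': "M' \<noteq> []" "distinct M'"
    by (auto simp: disjoint_ordered_sets_def)
  note T' = T[unfolded reflection_solutions_def argument_orders, THEN conjunct2, rule_format, OF disj]
  note c = commute_fam_at[OF lin] commute_fam_at[OF linear_entries_cnumber_family]
  from generically_conj[OF T' generically_conj[OF
      Q_commutation_generically[OF Q disj] Q_commutation_generically[OF Q disj']]]
  show "generically (\<lambda>l. fam_at (family_mult T ?Q) N l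
      \<circ> fused s R (\<lambda>x y. l x + l y) M' N
      \<circ> fam_at (family_mult T ?Q) M' l
      \<circ> fused s R (\<lambda>x y. l y - l x) (rev N) M'
    = fused s R (\<lambda>x y. l x - l y) M' (rev N)
      \<circ> fam_at (family_mult T ?Q) M' l
      \<circ> fused s R (\<lambda>x y. l x + l y) N M'
      \<circ> fam_at (family_mult T ?Q) N l)"
    unfolding fam_at_family_mult[OF lin N] fam_at_family_mult[OF lin M']
    by (rule generically_mono, intro dress_right) (auto intro: c disj disj')
qed

lemma reflection_solutions_mult_left:
  fixes R :: "complex \<Rightarrow> complex^('d::finite \<times> 'd)^('d \<times> 'd)"
  assumes S: "S_commutation R S" and T: "reflection_solutions s R T"
  shows "reflection_solutions s R (family_mult (cnumber_family s S) T)"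
  unfolding reflection_solutions_def argument_orders
proof (intro conjI allI impI)
  have lin: "linear_entries s T" using T by (simp add: reflection_solutions_def)
  let ?S = "cnumber_family s S"
  note linS = linear_entries_cnumber_family[of S]
  show "linear_entries s (family_mult ?S T)"
    by (intro linear_entries_family_mult lin linS)
  fix N M' :: "nat list" assume disj: "disjoint_ordered_sets N M'"
  then have disj': "disjoint_ordered_sets M' N" and N: "N \<noteq> []" "distinct N" and M': "M' \<noteq> []" "distinct M'"
    by (auto simp: disjoint_ordered_sets_def)
  note T' = T[unfolded reflection_solutions_def argument_orders, THEN conjunct2, rule_format, OF disj]
  note c = commute_fam_at[OF lin] commute_fam_at[OF linS]
  from generically_conj[OF T' generically_conj[OF
      S_commutation_generically[OF S disj] S_commutation_generically[OF S disj']]]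
  show "generically (\<lambda>l. fam_at (family_mult ?S T) N l
      \<circ> fused s R (\<lambda>x y. l x + l y) M' N
      \<circ> fam_at (family_mult ?S T) M' l
      \<circ> fused s R (\<lambda>x y. l y - l x) (rev N) M'
    = fused s R (\<lambda>x y. l x - l y) M' (rev N)
      \<circ> fam_at (family_mult ?S T) M' l
      \<circ> fused s R (\<lambda>x y. l x + l y) N M'
      \<circ> fam_at (family_mult ?S T) N l)"
    unfolding fam_at_family_mult[OF linS N] fam_at_family_mult[OF linS M']
    by (rule generically_mono, intro dress_left) (auto intro: c disj disj')
qed

text \<open>
  Grouping the factors \<open>M R M\<^sup>-\<^sup>1\<close> brings the dual equation into the shape of the direct one.
\<close>

lemma dual_reflection_solutions_iff:
  "dual_reflection_solutions s R M \<rho> K \<longleftrightarrow> linear_entries s K \<and>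
     (\<forall>N M'. disjoint_ordered_sets N M' \<longrightarrow> generically (\<lambda>l.
        fam_at K N l
          \<circ> (site_prod s M M' \<circ> fused s R (\<lambda>x y. - l x - l y - 2 * \<rho>) (rev M') (rev N)
              \<circ> site_prod s (matrix_inv M) (rev M'))
          \<circ> fam_at K M' l
          \<circ> fused s R (\<lambda>x y. l x - l y) N (rev M')
        = fused s R (\<lambda>x y. l y - l x) (rev M') N
          \<circ> fam_at K M' l
          \<circ> (site_prod s (matrix_inv M) (rev M') \<circ> fused s R (\<lambda>x y. - l x - l y - 2 * \<rho>) (rev N) (rev M')
              \<circ> site_prod s M M')
          \<circ> fam_at K N l))"
  unfolding dual_reflection_solutions_def argument_orders comp_assoc ..

lemma dual_reflection_solutions_mult_left:
  fixes R :: "complex \<Rightarrow> complex^('d::finite \<times> 'd)^('d \<times> 'd)"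
  assumes Q: "Q_commutation R Q" and K: "dual_reflection_solutions s R M \<rho> K"
    and M: "transpose M = M" "M ** matrix_inv M = mat 1" "matrix_inv M ** M = mat 1"
    and R: "crossing_unitarity R M \<rho>" "commutes_with_MM R M"
  shows "dual_reflection_solutions s R M \<rho> (family_mult (cnumber_family s Q) K)"
  unfolding dual_reflection_solutions_iff
proof (intro conjI allI impI)
  have lin: "linear_entries s K" using K by (simp add: dual_reflection_solutions_def)
  let ?Q = "cnumber_family s Q"
  note linQ = linear_entries_cnumber_family[of Q]
  show "linear_entries s (family_mult ?Q K)"
    by (intro linear_entries_family_mult lin linQ)
  fix N M' :: "nat list" assume disj: "disjoint_ordered_sets N M'"
  then have disj': "disjoint_ordered_sets M' N" and N: "N \<noteq> []" "distinct N" and M': "M' \<noteq> []" "distinct M'"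
    by (auto simp: disjoint_ordered_sets_def)
  note K' = K[unfolded dual_reflection_solutions_iff, THEN conjunct2, rule_format, OF disj]
  note c = commute_fam_at[OF lin] commute_fam_at[OF linQ]
  note crossed = commute_conjugated_fused(1)[OF disj' _ M] commute_conjugated_fused(2)[OF disj _ M]
  from generically_conj[OF K' generically_conj[OF generically_conj[OF
      Q_commutation_generically[OF Q disj] Q_commutation_generically[OF Q disj']]
      generically_conj[OF generically_crossing_unitary[OF R disj] generically_crossing_unitary[OF R disj']]]]
  show "generically (\<lambda>l. fam_at (family_mult ?Q K) N l
      \<circ> (site_prod s M M' \<circ> fused s R (\<lambda>x y. - l x - l y - 2 * \<rho>) (rev M') (rev N)
          \<circ> site_prod s (matrix_inv M) (rev M'))
      \<circ> fam_at (family_mult ?Q K) M' l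
      \<circ> fused s R (\<lambda>x y. l x - l y) N (rev M')
    = fused s R (\<lambda>x y. l y - l x) (rev M') N
      \<circ> fam_at (family_mult ?Q K) M' l
      \<circ> (site_prod s (matrix_inv M) (rev M') \<circ> fused s R (\<lambda>x y. - l x - l y - 2 * \<rho>) (rev N) (rev M')
          \<circ> site_prod s M M')
      \<circ> fam_at (family_mult ?Q K) N l)"
    unfolding fam_at_family_mult[OF linQ N] fam_at_family_mult[OF linQ M']
    by (rule generically_mono, intro dress_left) (auto intro: c disj disj' crossed)
qed

lemma dual_reflection_solutions_mult_right:
  fixes R :: "complex \<Rightarrow> complex^('d::finite \<times> 'd)^('d \<times> 'd)"
  assumes S: "S_commutation R S" and K: "dual_reflection_solutions s R M \<rho> K"
    and M: "transpose M = M" "M ** matrix_inv M = mat 1" "matrix_inv M ** M = mat 1"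
    and R: "crossing_unitarity R M \<rho>" "commutes_with_MM R M"
  shows "dual_reflection_solutions s R M \<rho> (family_mult K (cnumber_family s S))"
  unfolding dual_reflection_solutions_iff
proof (intro conjI allI impI)
  have lin: "linear_entries s K" using K by (simp add: dual_reflection_solutions_def)
  let ?S = "cnumber_family s S"
  show "linear_entries s (family_mult K ?S)"
    by (intro linear_entries_family_mult lin linear_entries_cnumber_family)
  fix N M' :: "nat list" assume disj: "disjoint_ordered_sets N M'"
  then have disj': "disjoint_ordered_sets M' N" and N: "N \<noteq> []" "distinct N" and M': "M' \<noteq> []" "distinct M'"
    by (auto simp: disjoint_ordered_sets_def)
  note K' = K[unfolded dual_reflection_solutions_iff, THEN conjunct2, rule_format, OF disj]
  note c = commute_fam_at[OF lin] commute_fam_at[OF linear_entries_cnumber_family]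
  note crossed = commute_conjugated_fused(1)[OF disj' _ M] commute_conjugated_fused(2)[OF disj _ M]
  from generically_conj[OF K' generically_conj[OF generically_conj[OF
      S_commutation_generically[OF S disj] S_commutation_generically[OF S disj']]
      generically_conj[OF generically_crossing_unitary[OF R disj] generically_crossing_unitary[OF R disj']]]]
  show "generically (\<lambda>l. fam_at (family_mult K ?S) N l
      \<circ> (site_prod s M M' \<circ> fused s R (\<lambda>x y. - l x - l y - 2 * \<rho>) (rev M') (rev N)
          \<circ> site_prod s (matrix_inv M) (rev M'))
      \<circ> fam_at (family_mult K ?S) M' l
      \<circ> fused s R (\<lambda>x y. l x - l y) N (rev M')
    = fused s R (\<lambda>x y. l y - l x) (rev M') N
      \<circ> fam_at (family_mult K ?S) M' l
      \<circ> (site_prod s (matrix_inv M) (rev M') \<circ> fused s R (\<lambda>x y. - l x - l y - 2 * \<rho>) (rev N) (rev M')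
          \<circ> site_prod s M M')
      \<circ> fam_at (family_mult K ?S) N l)"
    unfolding fam_at_family_mult[OF lin N] fam_at_family_mult[OF lin M']
    by (rule generically_mono, intro dress_right) (auto intro: c disj disj' crossed)
qed

end

lemma matrix_inv_of_invertible:
  fixes M :: "complex^'d^'d"
  assumes "M ** M' = mat 1" "M' ** M = mat 1"
  shows "M ** matrix_inv M = mat 1" "matrix_inv M ** M = mat 1"
  using someI[of "\<lambda>A'. M ** A' = mat 1 \<and> A' ** M = mat 1" M'] assms by (simp_all add: matrix_inv_def)

theorem proposition1:
  fixes R :: "complex \<Rightarrow> complex^('d::finite \<times> 'd)^('d \<times> 'd)"
    and V M :: "complex^'d^'d"
    and \<rho> :: complex
    and sq :: "complex \<Rightarrow> 'q::ab_group_add \<Rightarrow> 'q"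
    and sq' :: "complex \<Rightarrow> 'p::ab_group_add \<Rightarrow> 'p"
  assumes "yang_baxter R"
    and "transposition_symmetric R"
    and "unitarity R"
    and "V ** V = mat 1"
    and "M = transpose V ** V"
    and "crossing R V \<rho>"
    and "crossing_unitarity R M \<rho>"
    and "commutes_with_MM R M"
    and "vector_space sq"
    and "vector_space sq'"
  shows
    "(\<forall>Q. Q_commutation R Q \<longrightarrow>
        (\<forall>K. dual_reflection_solutions sq' R M \<rho> K \<longrightarrow>
             dual_reflection_solutions sq' R M \<rho> (family_mult (cnumber_family sq' Q) K)) \<and>
        (\<forall>T. reflection_solutions sq R T \<longrightarrow>
             reflection_solutions sq R (family_mult T (cnumber_family sq Q)))) \<and>
     (\<forall>S. S_commutation R S \<longrightarrow>
        (\<forall>K. dual_reflection_solutions sq' R M \<rho> K \<longrightarrow>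
             dual_reflection_solutions sq' R M \<rho> (family_mult K (cnumber_family sq' S))) \<and>
        (\<forall>T. reflection_solutions sq R T \<longrightarrow>
             reflection_solutions sq R (family_mult (cnumber_family sq S) T)))"
proof -
  have "quantum_space sq" "quantum_space sq'"
    using assms(9,10) by (simp_all add: quantum_space_def)
  then interpret q: quantum_space sq + q': quantum_space sq' .
  have tV: "transpose V ** transpose V = mat 1"
    using assms(4) by (metis matrix_transpose_mul transpose_mat)
  \<comment> \<open>As \<open>V\<close> is an involution, the inverse of \<open>M\<close> is \<open>V V\<^sup>t\<close>.\<close>
  have "M ** (V ** transpose V) = transpose V ** (V ** V) ** transpose V"
    "V ** transpose V ** M = V ** (transpose V ** transpose V) ** V"
    by (simp_all add: assms(5) matrix_mul_assoc)
  then have "M ** (V ** transpose V) = mat 1" "V ** transpose V ** M = mat 1"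
    by (simp_all add: assms(4) tV)
  then have inv: "M ** matrix_inv M = mat 1" "matrix_inv M ** M = mat 1"
    by (rule matrix_inv_of_invertible)+
  have sym: "transpose M = M"
    by (simp add: assms(5) matrix_transpose_mul)
  show ?thesis
    using q'.dual_reflection_solutions_mult_left[OF _ _ sym inv assms(7,8)]
      q'.dual_reflection_solutions_mult_right[OF _ _ sym inv assms(7,8)]
      q.reflection_solutions_mult_left q.reflection_solutions_mult_right
    by blast
qed

end
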